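(* Let $G$ be a simple undirected connected graph on $\{1,\dots,N\}$, $N\ge2$, with adjacency matrix $A=[a_{\ell k}]$ and combinatorial Laplacian $L$, whose largest eigenvalue is $\lambda_{\max}(L)$. Let $\mu>0$, $\omega_1,\dots,\omega_N\in\mathbb R$, and assume $$0<c<c^*:=\frac{2\mu}{3\sqrt{3N}\,\lambda_{\max}(L)}.$$ Let $r^*$ denote the smaller positive root of $\mu x-x^3=c\sqrt{N\mu}\,\lambda_{\max}(L)$. Let $z$ be the solution of $$\dot z_\ell=(\mu+\mathrm i\omega_\ell)z_\ell-|z_\ell|^2z_\ell+c\sum_{k=1}^N a_{\ell k}(z_k-z_\ell),\qquad \ell=1,\dots,N,$$ and write $r_\ell(t)=|z_\ell(t)|$. Suppose that the initial data satisfy $$\sum_{\ell=1}^N r_\ell^2(0)<N\mu,\qquad r_\ell(0)>r^*,\quad \ell=1,\dots,N.$$ Then the solution $z(t)$ exists globally and satisfies $$\sum_{\ell=1}^N r_\ell^2(t)<N\mu,\qquad r_\ell(t)>r^*,\qquad t\ge0,\quad \ell=1,\dots,N.$$ Consequently, no component undergoes amplitude death, the polar representation $z_\ell=r_\ell e^{\mathrm i\theta_\ell}$ is globally well-defined, and for all $t\ge0$ the system for $z$ is equivalent to the polar system $$\dot r_\ell=(\mu-r_\ell^2)r_\ell+c\sum_{k=1}^N a_{\ell k}\left(r_k\cos(\theta_k-\theta_\ell)-r_\ell\right),\qquad \dot\theta_\ell=\omega_\ell+c\sum_{k=1}^N a_{\ell k}\frac{r_k}{r_\ell}\sin(\theta_k-\theta_\ell).$$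 Moreover, $$\limsup_{t\to\infty}\max_{1\le\ell\le N}r_\ell(t)\le\sqrt\mu.$$
   Context: Graph conventions: $a_{\ell k}\in\{0,1\}$, $a_{\ell\ell}=0$, $a_{\ell k}=a_{k\ell}$; $d_\ell=\sum_k a_{\ell k}$, $D=\mathrm{diag}(d_1,\dots,d_N)$, $L=D-A$. The angles $\theta_\ell$ are unwrapped, i.e. continuous real-valued functions with $e^{\mathrm i\theta_\ell(t)}=z_\ell(t)/r_\ell(t)$ wherever $r_\ell>0$. Amplitude death of a component means that its amplitude $r_\ell$ reaches $0$. *)

theory Defs
  imports "HOL-Analysis.Analysis"
begin

text \<open>The vertex set is the finite type \<open>'n\<close>, so \<open>N = CARD('n)\<close>. A graph is given by its adjacency
  matrix.\<close>

definition simple_graph_adjacency :: "real ^ 'n ^ 'n \<Rightarrow> bool" where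
  "simple_graph_adjacency A \<longleftrightarrow>
     (\<forall>l k. A $ l $ k \<in> {0, 1}) \<and> (\<forall>l. A $ l $ l = 0) \<and> (\<forall>l k. A $ l $ k = A $ k $ l)"

definition connected_graph_adjacency :: "real ^ 'n ^ 'n \<Rightarrow> bool" where
  "connected_graph_adjacency A \<longleftrightarrow> (\<forall>l k. (\<lambda>u v. A $ u $ v = 1)\<^sup>*\<^sup>* l k)"

definition graph_degree :: "real ^ 'n ^ 'n \<Rightarrow> 'n::finite \<Rightarrow> real" where
  "graph_degree A l = (\<Sum>k\<in>UNIV. A $ l $ k)"

definition graph_laplacian :: "real ^ 'n ^ 'n \<Rightarrow> real ^ 'n ^ ('n::finite)" where
  "graph_laplacian A = (\<chi> l k. if l = k then graph_degree A l else 0) - A"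

definition real_eigenvalue :: "real ^ 'n ^ 'n \<Rightarrow> real \<Rightarrow> bool" where
  "real_eigenvalue M x \<longleftrightarrow> (\<exists>v. v \<noteq> 0 \<and> M *v v = x *\<^sub>R v)"

text \<open>Only real eigenvalues are considered; this loses nothing for the symmetric matrices to which
  the definition is applied, and their set of eigenvalues is finite and nonempty.\<close>

definition lambda_max :: "real ^ 'n ^ 'n \<Rightarrow> real" where
  "lambda_max M = Max {x. real_eigenvalue M x}"

definition c_star :: "real ^ 'n ^ 'n \<Rightarrow> real \<Rightarrow> real" where
  "c_star A \<mu> =
     2 * \<mu> / (3 * sqrt (3 * real CARD('n)) * lambda_max (graph_laplacian A))"

text \<open>For \<open>0 < c < c_star A \<mu>\<close> the cubic equation below has exactly two positive roots; \<open>r_star\<close> is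
  the smaller one.\<close>

definition r_star :: "real ^ 'n ^ 'n \<Rightarrow> real \<Rightarrow> real \<Rightarrow> real" where
  "r_star A \<mu> c =
     Min {x. x > 0 \<and>
             \<mu> * x - x ^ 3 = c * sqrt (real CARD('n) * \<mu>) * lambda_max (graph_laplacian A)}"

definition sl_field ::
  "real ^ 'n ^ 'n \<Rightarrow> real \<Rightarrow> real ^ 'n \<Rightarrow> real \<Rightarrow> complex ^ 'n \<Rightarrow> complex ^ ('n::finite)" where
  "sl_field A \<mu> \<omega> c z = (\<chi> l.
     (complex_of_real \<mu> + \<i> * complex_of_real (\<omega> $ l)) * z $ l
     - complex_of_real ((cmod (z $ l))\<^sup>2) * z $ l
     + complex_of_real c * (\<Sum>k\<in>UNIV. complex_of_real (A $ l $ k) * (z $ k - z $ l)))"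

text \<open>Solutions are taken on a set \<open>J\<close> of times, with one-sided derivatives at its end points.\<close>

definition sl_solution_on ::
  "real set \<Rightarrow> real ^ 'n ^ 'n \<Rightarrow> real \<Rightarrow> real ^ 'n \<Rightarrow> real \<Rightarrow> (real \<Rightarrow> complex ^ ('n::finite)) \<Rightarrow> bool"
where
  "sl_solution_on J A \<mu> \<omega> c z \<longleftrightarrow>
     (\<forall>t\<in>J. (z has_vector_derivative sl_field A \<mu> \<omega> c (z t)) (at t within J))"

definition polar_solution_on ::
  "real set \<Rightarrow> real ^ 'n ^ 'n \<Rightarrow> real \<Rightarrow> real ^ 'n \<Rightarrow> real
     \<Rightarrow> (real \<Rightarrow> real ^ 'n) \<Rightarrow> (real \<Rightarrow> real ^ ('n::finite)) \<Rightarrow> bool"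
where
  "polar_solution_on J A \<mu> \<omega> c r \<theta> \<longleftrightarrow> (\<forall>t\<in>J. \<forall>l.
     ((\<lambda>s. r s $ l) has_real_derivative
        (\<mu> - (r t $ l)\<^sup>2) * r t $ l
        + c * (\<Sum>k\<in>UNIV. A $ l $ k * (r t $ k * cos (\<theta> t $ k - \<theta> t $ l) - r t $ l)))
       (at t within J) \<and>
     ((\<lambda>s. \<theta> s $ l) has_real_derivative
        \<omega> $ l
        + c * (\<Sum>k\<in>UNIV. A $ l $ k * (r t $ k / r t $ l) * sin (\<theta> t $ k - \<theta> t $ l)))
       (at t within J))"

definition amplitude :: "(real \<Rightarrow> complex ^ 'n) \<Rightarrow> real \<Rightarrow> real ^ ('n::finite)" where
  "amplitude z t = (\<chi> l. cmod (z t $ l))"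

definition amplitude_death :: "(real \<Rightarrow> complex ^ 'n) \<Rightarrow> 'n::finite \<Rightarrow> bool" where
  "amplitude_death z l \<longleftrightarrow> (\<exists>t\<ge>0. amplitude z t $ l = 0)"

definition unwrapped_angles ::
  "(real \<Rightarrow> complex ^ 'n) \<Rightarrow> (real \<Rightarrow> real ^ ('n::finite)) \<Rightarrow> bool" where
  "unwrapped_angles z \<theta> \<longleftrightarrow>
     continuous_on {0..} \<theta> \<and>
     (\<forall>t\<ge>0. \<forall>l. amplitude z t $ l > 0 \<longrightarrow>
        exp (\<i> * complex_of_real (\<theta> t $ l)) = z t $ l / complex_of_real (amplitude z t $ l))"

definition from_polar ::
  "(real \<Rightarrow> real ^ 'n) \<Rightarrow> (real \<Rightarrow> real ^ 'n) \<Rightarrow> real \<Rightarrow> complex ^ ('n::finite)" where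
  "from_polar r \<theta> t =
     (\<chi> l. complex_of_real (r t $ l) * exp (\<i> * complex_of_real (\<theta> t $ l)))"

text \<open>Every component has an unwrapped angle, which is unique up to a constant multiple of
  \<open>2 * pi\<close>, and the angles recover \<open>z\<close> at all times \<open>t \<ge> 0\<close>.\<close>

definition polar_representation_well_defined ::
  "(real \<Rightarrow> complex ^ ('n::finite)) \<Rightarrow> bool" where
  "polar_representation_well_defined z \<longleftrightarrow>
     (\<exists>\<theta>. unwrapped_angles z \<theta>) \<and>
     (\<forall>\<theta>. unwrapped_angles z \<theta> \<longrightarrow> (\<forall>t\<ge>0. z t = from_polar (amplitude z) \<theta> t)) \<and>
     (\<forall>\<theta> \<theta>'. unwrapped_angles z \<theta> \<and> unwrapped_angles z \<theta>' \<longrightarrow>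
        (\<forall>l. \<exists>m::int. \<forall>t\<ge>0. \<theta>' t $ l = \<theta> t $ l + 2 * pi * of_int m))"

end

theory Submission
  imports Defs
begin

text \<open>
  Three scalar differential inequalities carry the theorem. Write \<open>S = \<Sum>r\<^sub>l\<^sup>2\<close> for the total energy
  and \<open>N\<close> for the number of oscillators.

  \<^item> The Laplacian form \<open>\<Sum>A\<^sub>l\<^sub>k z\<^sub>l \<bullet> (z\<^sub>l - z\<^sub>k)\<close> is nonnegative, so the coupling only removes
    energy; with the Cauchy--Schwarz inequality this gives \<open>S' \<le> 2 (\<mu> - S / N) S\<close>, and \<open>S < N \<mu>\<close>
    persists.

  \<^item> In that ball the coupling term \<open>(L z)\<^sub>l\<close> has modulus at most \<open>\<lambda>\<^sub>m\<^sub>a\<^sub>x \<parallel>z\<parallel> < \<lambda>\<^sub>m\<^sub>a\<^sub>x sqrt (N \<mu>)\<close>, so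
    \<open>r\<^sub>l' > \<mu> r\<^sub>l - r\<^sub>l\<^sup>3 - c \<lambda>\<^sub>m\<^sub>a\<^sub>x sqrt (N \<mu>)\<close>. The right-hand side vanishes at \<open>r\<^sup>*\<close>: an amplitude that
    came down to \<open>r\<^sup>*\<close> would be strictly increasing there.

  \<^item> At an index of maximal amplitude the coupling points inwards, so the maximum \<open>M\<close> satisfies
    \<open>M' \<le> (\<mu> - M\<^sup>2) M\<close> and stays below the supersolution \<open>sqrt \<mu> + C exp (- \<mu> t)\<close>.

  Each of them is used in the form of the first-contact principle \<open>barrier_positive\<close>. Global
  existence comes from cutting off the cubic term outside the invariant ball, which makes the field
  globally Lipschitz (\<open>global_solution_of_Lipschitz_field\<close>), and then observing that the solution
  never leaves the ball, where nothing was changed. Uniqueness on any interval holds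
  because the field is one-sided Lipschitz on the whole space, with constant \<open>\<mu>\<close>
  (\<open>sl_field_one_sided_Lipschitz\<close>). The bound by \<open>\<lambda>\<^sub>m\<^sub>a\<^sub>x\<close> rests on the variational description of the
  largest eigenvalue of a symmetric matrix (\<open>Rayleigh_quotient_eigenvalue\<close>).

  Once the amplitudes are positive, the angles are imaginary parts of continuous logarithms. They
  inherit differentiability from \<open>z\<close> because near each time \<open>t\<close> a continuous angle differs by a
  constant from the principal argument of \<open>z s / z t\<close> (\<open>polar_derivative_iff\<close>), and the polar system consists of the real
  and imaginary parts of the field rotated by \<open>exp (- i \<theta>\<^sub>l)\<close>.
\<close>

section \<open>First contact with a barrier\<close>

text \<open>At the first time \<open>t\<close> at which some \<open>g j\<close> reaches \<open>0\<close>, it came down from positive values, so its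
  derivative cannot be positive. The strict sign is therefore needed only at points of contact,
  where moreover the other functions are known to be nonnegative.\<close>

lemma barrier_positive:
  fixes g g' :: "'i::finite \<Rightarrow> real \<Rightarrow> real"
  assumes init: "\<And>i. 0 < g i 0"
    and der: "\<And>i t. 0 \<le> t \<Longrightarrow> (g i has_real_derivative g' i t) (at t within {0..})"
    and inward: "\<And>i t. 0 < t \<Longrightarrow> (\<And>j. 0 \<le> g j t) \<Longrightarrow> g i t = 0 \<Longrightarrow> 0 < g' i t"
    and "0 \<le> T"
  shows "0 < g i T"
proof (rule ccontr)
  assume neg: "\<not> 0 < g i T"
  have cont: "continuous_on {0..} (g j)" for j
    using der by (auto simp: continuous_on_eq_continuous_within intro!: DERIV_continuous)
  define B where "B = (\<Union>j. {s \<in> {0..T}. g j s \<le> 0})"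
  have "closed {s \<in> {0..T}. g j s \<le> 0}" for j
    by (intro continuous_on_closed_Collect_le continuous_on_subset[OF cont] continuous_intros) auto
  then have "closed B"
    unfolding B_def by (intro closed_UN) auto
  moreover have "T \<in> B"
    using neg \<open>0 \<le> T\<close> by (auto simp: B_def not_less)
  moreover have "bdd_below B"
    by (rule bdd_belowI[of _ 0]) (auto simp: B_def)
  ultimately have InfB: "Inf B \<in> B" and least: "\<And>s. s \<in> B \<Longrightarrow> Inf B \<le> s"
    using closed_contains_Inf[of B] cInf_lower[of _ B] by auto
  define t where "t = Inf B"
  obtain j where j: "0 \<le> t" "t \<le> T" "g j t \<le> 0"
    using InfB by (auto simp: B_def t_def)
  have "0 < t"
    using j init[of j] by (cases "t = 0") auto
  have before: "0 < g k s" if "0 \<le> s" "s < t" for k s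
  proof (rule ccontr)
    assume "\<not> 0 < g k s"
    then have "s \<in> B"
      using that j by (auto simp: B_def not_less)
    then show False
      using least[of s] that by (simp add: t_def)
  qed
  have nonneg: "0 \<le> g k t" for k
  proof (rule ccontr)
    assume "\<not> 0 \<le> g k t"
    then obtain s where "0 \<le> s" "s \<le> t" "g k s = 0"
      using IVT2'[of "g k" t 0 0] init[of k] \<open>0 < t\<close> continuous_on_subset[OF cont[of k], of "{0..t}"]
      by auto
    then show False
      using before[of s k] \<open>\<not> 0 \<le> g k t\<close> by (cases "s = t") auto
  qed
  then have "g j t = 0"
    using j(3) by (simp add: antisym)
  then have "0 < g' j t"
    using inward[of t j] nonneg \<open>0 < t\<close> by auto
  then obtain d where d: "0 < d" "\<And>h. 0 < h \<Longrightarrow> t - h \<in> {0..} \<Longrightarrow> h < d \<Longrightarrow> g j (t - h) < g j t"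
    using has_real_derivative_pos_inc_left[OF der[OF j(1), of j]] by blast
  have "g j (t - min (d/2) t) < 0"
    using d(2)[of "min (d/2) t"] d(1) \<open>0 < t\<close> \<open>g j t = 0\<close> by auto
  then show False
    using before[of "t - min (d/2) t" j] d(1) \<open>0 < t\<close> by auto
qed

section \<open>Global solutions of Lipschitz equations\<close>

lemma integral_has_vector_derivative_halfline:
  fixes h :: "real \<Rightarrow> 'a::banach"
  assumes "continuous_on {0..} h" "0 \<le> t"
  shows "((\<lambda>u. integral {0..u} h) has_vector_derivative h t) (at t within {0..})"
proof -
  have "((\<lambda>u. integral {0..u} h) has_vector_derivative h t) (at t within {0..t+1})"
    using assms by (intro integral_has_vector_derivative continuous_on_subset[OF assms(1)]) auto
  moreover have "at t within {0..t+1} = at t within {0..}"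
    by (rule at_within_nhd[of t "{..<t+1}"]) auto
  ultimately show ?thesis by simp
qed

text \<open>The estimate behind the weighted norm of Bielecki: an integrand of size \<open>exp (K s)\<close> loses a factor
  \<open>K\<close> when integrated. It serves both to keep the Picard operator inside the bounded functions and
  to make it a contraction.\<close>

lemma exp_weighted_integral_bound:
  fixes h :: "real \<Rightarrow> 'a::euclidean_space"
  assumes "continuous_on {0..} h" "0 \<le> t" "0 < K" "0 \<le> C"
    and bound: "\<And>s. 0 \<le> s \<Longrightarrow> norm (h s) \<le> C * exp (K * s)"
  shows "exp (- K * t) * norm (integral {0..t} h) \<le> C / K"
proof -
  have I: "((\<lambda>s. C * exp (K * s)) has_integral (C / K * exp (K * t) - C / K * exp (K * 0))) {0..t}"
    using assms by (intro fundamental_theorem_of_calculus)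
      (auto intro!: derivative_eq_intros simp: has_real_derivative_iff_has_vector_derivative[symmetric])
  have "norm (integral {0..t} h) \<le> integral {0..t} (\<lambda>s. C * exp (K * s))"
    using assms I
    by (intro integral_norm_bound_integral integrable_continuous_real)
       (auto intro!: continuous_intros intro: continuous_on_subset)
  also have "\<dots> = C / K * (exp (K * t) - 1)"
    using integral_unique[OF I] by (simp add: algebra_simps)
  also have "\<dots> \<le> C / K * exp (K * t)"
    using assms by (intro mult_left_mono) auto
  finally have "exp (- K * t) * norm (integral {0..t} h) \<le> exp (- K * t) * (C / K * exp (K * t))"
    by (intro mult_left_mono) auto
  also have "\<dots> = C / K"
    by (simp add: exp_minus)
  finally show ?thesis .
qed

text \<open>Picard iteration on the whole half-line at once. In terms of \<open>y t = exp (- K t) x t\<close>, with \<open>K\<close>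
  twice the Lipschitz constant, the integral equation becomes a fixed point problem for a map of the
  bounded continuous functions that halves distances.\<close>

theorem global_solution_of_Lipschitz_field:
  fixes f :: "'a::euclidean_space \<Rightarrow> 'a"
  assumes lip: "\<And>x y. norm (f x - f y) \<le> L * norm (x - y)"
  obtains x where "x 0 = x0"
    and "\<And>t. 0 \<le> t \<Longrightarrow> (x has_vector_derivative f (x t)) (at t within {0..})"
proof -
  (* The maximum with 1 makes the rate K positive also if f is constant. *)
  define M where "M = max 1 L"
  define K where "K = 2 * M"
  have M: "0 < M" "0 < K" "1 \<le> M"
    by (auto simp: M_def K_def)
  have lipM: "norm (f x - f y) \<le> M * norm (x - y)" for x y
    by (rule order_trans[OF lip]) (auto simp: M_def intro!: mult_right_mono)
  have contf: "continuous_on UNIV f"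
    using lipM M by (intro lipschitz_on_continuous_on[of M] lipschitz_onI) (auto simp: dist_norm)
  define h where "h y s = f (exp (K * s) *\<^sub>R apply_bcontfun y s)" for y :: "real \<Rightarrow>\<^sub>C 'a" and s
  have conth: "continuous_on S (h y)" for S y
    unfolding h_def by (intro continuous_on_compose2[OF contf] continuous_intros) auto
  (* Bounded continuous functions live on the whole line here, so times before 0 are clamped to 0. *)
  define P where "P y t = exp (- K * max 0 t) *\<^sub>R (x0 + integral {0..max 0 t} (h y))" for y t
  have contI: "continuous_on {0..} (\<lambda>u. integral {0..u} (h y))" for y
    using integral_has_vector_derivative_halfline[OF conth]
    by (auto simp: continuous_on_eq_continuous_within intro!: has_vector_derivative_continuous)
  have contP: "continuous_on UNIV (P y)" for y
    unfolding P_def by (intro continuous_intros continuous_on_compose2[OF contI]) auto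
  have boundP: "norm (P y t) \<le> norm x0 + (norm (f 0) + M * norm y) / K" for y t
  proof -
    define u where "u = max 0 t"
    have u: "0 \<le> u" by (auto simp: u_def)
    have "norm (h y s) \<le> (norm (f 0) + M * norm y) * exp (K * s)" if "0 \<le> s" for s
    proof -
      have "norm (h y s) \<le> norm (f 0) + norm (h y s - f 0)"
        using norm_triangle_sub[of "h y s" "f 0"] by simp
      also have "norm (h y s - f 0) \<le> M * (exp (K * s) * norm (apply_bcontfun y s))"
        using lipM[of "exp (K * s) *\<^sub>R apply_bcontfun y s" 0] by (simp add: h_def)
      also have "\<dots> \<le> M * (exp (K * s) * norm y)"
        using M norm_bounded[of y s] by (intro mult_left_mono) auto
      also have "norm (f 0) \<le> norm (f 0) * exp (K * s)"
        using that M by (simp add: mult_le_cancel_left1)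
      finally show ?thesis by (simp add: algebra_simps)
    qed
    then have "exp (- K * u) * norm (integral {0..u} (h y)) \<le> (norm (f 0) + M * norm y) / K"
      using M u by (intro exp_weighted_integral_bound conth) auto
    moreover have "exp (- K * u) * norm x0 \<le> norm x0"
      using M u by (intro mult_left_le_one_le) auto
    moreover have "norm (P y t) \<le> exp (- K * u) * (norm x0 + norm (integral {0..u} (h y)))"
      unfolding P_def u_def[symmetric] by (auto intro!: norm_triangle_ineq mult_left_mono)
    ultimately show ?thesis by (simp add: algebra_simps)
  qed
  define \<Phi> where "\<Phi> y = Bcontfun (P y)" for y
  have apply\<Phi>: "apply_bcontfun (\<Phi> y) = P y" for y
    unfolding \<Phi>_def by (intro Bcontfun_inverse bcontfun_normI[OF contP boundP])
  have "dist (\<Phi> y) (\<Phi> z) \<le> 1/2 * dist y z" for y z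
  proof (rule dist_bound)
    fix t :: real
    define u where "u = max 0 t"
    have u: "0 \<le> u" by (auto simp: u_def)
    have "norm (h y s - h z s) \<le> (M * dist y z) * exp (K * s)" if "0 \<le> s" for s
    proof -
      have "norm (h y s - h z s) \<le> M * (exp (K * s) * norm (apply_bcontfun y s - apply_bcontfun z s))"
        using lipM[of "exp (K * s) *\<^sub>R apply_bcontfun y s" "exp (K * s) *\<^sub>R apply_bcontfun z s"]
        by (simp add: h_def scaleR_diff_right[symmetric])
      also have "\<dots> \<le> M * (exp (K * s) * dist y z)"
        using M dist_bounded[of y s z] by (intro mult_left_mono) (auto simp: dist_norm)
      finally show ?thesis by (simp add: algebra_simps)
    qed
    then have "exp (- K * u) * norm (integral {0..u} (\<lambda>s. h y s - h z s)) \<le> (M * dist y z) / K"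
      using M u by (intro exp_weighted_integral_bound continuous_intros conth) auto
    moreover have "integral {0..u} (\<lambda>s. h y s - h z s) = integral {0..u} (h y) - integral {0..u} (h z)"
      by (intro integral_diff integrable_continuous_real conth)
    moreover have "P y t - P z t = exp (- K * u) *\<^sub>R (integral {0..u} (h y) - integral {0..u} (h z))"
      unfolding P_def u_def by (simp add: algebra_simps)
    ultimately have "norm (P y t - P z t) \<le> M * dist y z / K"
      by simp
    then show "dist (apply_bcontfun (\<Phi> y) t) (apply_bcontfun (\<Phi> z) t) \<le> 1/2 * dist y z"
      using M by (simp add: apply\<Phi> dist_norm[symmetric] K_def)
  qed
  then obtain y where y: "\<Phi> y = y"
    using banach_fix_type[of "1/2" \<Phi>] by auto
  define x where "x t = x0 + integral {0..t} (h y)" for t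
  show ?thesis
  proof
    show "x 0 = x0" by (simp add: x_def)
    fix t :: real assume t: "0 \<le> t"
    have "apply_bcontfun y t = P y t"
      using apply\<Phi>[of y] y by simp
    then have "exp (K * t) *\<^sub>R apply_bcontfun y t = x t"
      using t by (simp add: P_def x_def mult_exp_exp)
    then have "h y t = f (x t)"
      by (simp add: h_def)
    moreover have "(x has_vector_derivative h y t) (at t within {0..})"
      unfolding x_def
      using has_vector_derivative_add[OF has_vector_derivative_const
          integral_has_vector_derivative_halfline[OF conth t]] by simp
    ultimately show "(x has_vector_derivative f (x t)) (at t within {0..})"
      by simp
  qed
qed

section \<open>Symmetric matrices\<close>

lemma symmetric_matrix_inner:
  fixes M :: "real ^ 'n ^ 'n"
  assumes "transpose M = M"
  shows "(M *v x) \<bullet> y = x \<bullet> (M *v y)"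
  by (metis assms dot_lmul_matrix vector_transpose_matrix)

text \<open>The usual discriminant argument, for a form that may be degenerate. It is applied twice: to
  \<open>\<rho> I - M\<close> in order to see that a maximizer of the Rayleigh quotient is an eigenvector, and to \<open>M\<close>
  itself in order to bound its norm.\<close>

lemma psd_Cauchy_Schwarz:
  fixes f :: "'a::real_inner \<Rightarrow> 'a"
  assumes lin: "linear f" and sym: "\<And>x y. f x \<bullet> y = x \<bullet> f y" and psd: "\<And>x. 0 \<le> x \<bullet> f x"
  shows "(x \<bullet> f y)\<^sup>2 \<le> (x \<bullet> f x) * (y \<bullet> f y)"
proof -
  have q: "0 \<le> x \<bullet> f x - 2 * t * (x \<bullet> f y) + t\<^sup>2 * (y \<bullet> f y)" for t
  proof -
    have "y \<bullet> f x = x \<bullet> f y"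
      using sym[of x y] by (simp add: inner_commute)
    then show ?thesis
      using psd[of "x - t *\<^sub>R y"]
      by (simp add: linear_diff[OF lin] linear_scale[OF lin] inner_diff_left inner_diff_right
          power2_eq_square algebra_simps)
  qed
  show ?thesis
  proof (cases "y \<bullet> f y = 0")
    case True
    have "x \<bullet> f y = 0"
    proof (rule ccontr)
      assume "x \<bullet> f y \<noteq> 0"
      then show False
        using q[of "(x \<bullet> f x + 1) / (2 * (x \<bullet> f y))"] True by simp
    qed
    then show ?thesis using True by simp
  next
    case False
    then have pos: "0 < y \<bullet> f y"
      using psd[of y] by simp
    have "0 \<le> x \<bullet> f x - (x \<bullet> f y)\<^sup>2 / (y \<bullet> f y)"
      using q[of "(x \<bullet> f y) / (y \<bullet> f y)"] False by (simp add: field_simps power2_eq_square)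
    then show ?thesis
      using pos by (simp add: field_simps)
  qed
qed

text \<open>Eigenvectors for different eigenvalues are orthogonal, hence independent. This makes the maximum in
  \<open>lambda_max\<close> one over a finite set.\<close>

lemma finite_real_eigenvalues:
  fixes M :: "real ^ 'n ^ 'n"
  assumes sym: "transpose M = M"
  shows "finite {x. real_eigenvalue M x}"
proof -
  let ?E = "{x. real_eigenvalue M x}"
  have "\<forall>x\<in>?E. \<exists>v. v \<noteq> 0 \<and> M *v v = x *\<^sub>R v"
    by (simp add: real_eigenvalue_def)
  then obtain v where "\<forall>x\<in>?E. v x \<noteq> 0 \<and> M *v v x = x *\<^sub>R v x"
    using bchoice by metis
  then have v: "v x \<noteq> 0" "M *v v x = x *\<^sub>R v x" if "x \<in> ?E" for x
    using that by auto
  have orth: "v x \<bullet> v y = 0" if "x \<in> ?E" "y \<in> ?E" "x \<noteq> y" for x y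
    using symmetric_matrix_inner[OF sym, of "v x" "v y"] v(2)[OF that(1)] v(2)[OF that(2)] that(3)
    by simp
  have "pairwise orthogonal (v ` ?E)"
    using orth by (auto simp: pairwise_def orthogonal_def)
  moreover have "0 \<notin> v ` ?E"
    using v(1) by force
  ultimately have "finite (v ` ?E)"
    using pairwise_orthogonal_independent independent_imp_finite by blast
  moreover have "inj_on v ?E"
    using orth v(1) by (intro inj_onI) (metis inner_eq_zero_iff)
  ultimately show ?thesis
    using finite_imageD by blast
qed

text \<open>A maximizer \<open>v\<close> of the form on the unit sphere is a null vector of the positive semidefinite form of
  \<open>\<rho> I - M\<close>, and a null vector of such a form lies in the kernel.\<close>

lemma Rayleigh_quotient_eigenvalue:
  fixes M :: "real ^ 'n ^ 'n"
  assumes sym: "transpose M = M"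
  obtains \<rho> where "real_eigenvalue M \<rho>" and "\<And>x. x \<bullet> (M *v x) \<le> \<rho> * (norm x)\<^sup>2"
proof -
  have "\<exists>v\<in>sphere 0 1. \<forall>x\<in>sphere 0 1. x \<bullet> (M *v x) \<le> v \<bullet> (M *v v)"
    by (intro continuous_attains_sup continuous_intros linear_continuous_on) auto
  then obtain v where v: "norm v = 1" "\<And>x. norm x = 1 \<Longrightarrow> x \<bullet> (M *v x) \<le> v \<bullet> (M *v v)"
    by auto
  define \<rho> where "\<rho> = v \<bullet> (M *v v)"
  have max: "x \<bullet> (M *v x) \<le> \<rho> * (norm x)\<^sup>2" for x
  proof (cases "x = 0")
    case False
    have "(x /\<^sub>R norm x) \<bullet> (M *v (x /\<^sub>R norm x)) \<le> \<rho>"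
      using v(2)[of "x /\<^sub>R norm x"] False by (simp add: \<rho>_def)
    then show ?thesis
      using False by (simp add: matrix_vector_mult_scaleR field_simps power2_eq_square)
  qed simp
  define f where "f x = \<rho> *\<^sub>R x - M *v x" for x
  have lin: "linear f"
    unfolding f_def by (intro linear_compose_sub linear_scale_self matrix_vector_mul_linear)
  have fsym: "f x \<bullet> y = x \<bullet> f y" for x y
    by (simp add: f_def inner_diff_left inner_diff_right symmetric_matrix_inner[OF sym])
  have psd: "0 \<le> x \<bullet> f x" for x
    using max[of x] by (simp add: f_def inner_diff_right power2_norm_eq_inner)
  have "v \<bullet> f v = 0"
    using v(1) by (simp add: f_def inner_diff_right \<rho>_def norm_eq_1)
  then have "(f v \<bullet> f v)\<^sup>2 \<le> 0"
    using psd_Cauchy_Schwarz[of f "f v" v] lin fsym psd by simp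
  then have "f v = 0" by simp
  then have "real_eigenvalue M \<rho>"
    using v(1) unfolding real_eigenvalue_def f_def by (intro exI[of _ v]) auto
  then show ?thesis
    using max that by blast
qed

text \<open>The Cauchy--Schwarz inequality for the form of \<open>M\<close>, applied to \<open>M x\<close> and \<open>x\<close>, turns the bound on
  the form into a bound on \<open>M\<close>.\<close>

lemma psd_norm_le_lambda_max:
  fixes M :: "real ^ 'n ^ 'n"
  assumes sym: "transpose M = M" and psd: "\<And>x. 0 \<le> x \<bullet> (M *v x)" and "0 \<le> lambda_max M"
  shows "norm (M *v x) \<le> lambda_max M * norm x"
proof -
  let ?\<Lambda> = "lambda_max M"
  obtain \<rho> where \<rho>: "real_eigenvalue M \<rho>" "\<And>x. x \<bullet> (M *v x) \<le> \<rho> * (norm x)\<^sup>2"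
    using Rayleigh_quotient_eigenvalue[OF sym] by blast
  have "\<rho> \<le> ?\<Lambda>"
    unfolding lambda_max_def using \<rho>(1) finite_real_eigenvalues[OF sym] by (intro Max_ge) auto
  then have max: "x \<bullet> (M *v x) \<le> ?\<Lambda> * (norm x)\<^sup>2" for x
    by (rule order_trans[OF \<rho>(2) mult_right_mono]) auto
  define y where "y = M *v x"
  have "(y \<bullet> (M *v x))\<^sup>2 \<le> (y \<bullet> (M *v y)) * (x \<bullet> (M *v x))"
    using symmetric_matrix_inner[OF sym] psd by (intro psd_Cauchy_Schwarz) auto
  also have "\<dots> \<le> (?\<Lambda> * (norm y)\<^sup>2) * (?\<Lambda> * (norm x)\<^sup>2)"
    using max psd assms(3) by (intro mult_mono) auto
  finally have *: "(norm y)\<^sup>2 * (norm y)\<^sup>2 \<le> (norm y)\<^sup>2 * (?\<Lambda> * norm x)\<^sup>2"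
    by (simp add: y_def power2_norm_eq_inner[symmetric] power2_eq_square algebra_simps)
  have "(norm y)\<^sup>2 \<le> (?\<Lambda> * norm x)\<^sup>2" if "y \<noteq> 0"
    using * that mult_le_cancel_left_pos[of "(norm y)\<^sup>2" "(norm y)\<^sup>2" "(?\<Lambda> * norm x)\<^sup>2"] by simp
  then have "y = 0 \<or> (norm y)\<^sup>2 \<le> (?\<Lambda> * norm x)\<^sup>2"
    by blast
  then show ?thesis
    using assms(3) by (auto simp: y_def intro: power2_le_imp_le)
qed

section \<open>The Laplacian coupling\<close>

lemma sum_norm_square_vec: "(norm z)\<^sup>2 = (\<Sum>l\<in>UNIV. (norm (z $ l))\<^sup>2)"
  for z :: "'a::real_inner ^ 'n"
  by (simp add: power2_norm_eq_inner inner_vec_def)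

lemma graph_laplacian_mult_nth:
  "(graph_laplacian A *v x) $ l = (\<Sum>k\<in>UNIV. A $ l $ k * (x $ l - x $ k))"
  by (simp add: matrix_vector_mult_def graph_laplacian_def graph_degree_def left_diff_distrib
      right_diff_distrib sum_subtractf sum_distrib_right if_distrib[of "\<lambda>a. a * _"] cong: if_cong)

text \<open>Adding the sum to its copy with the two indices exchanged completes each square. The entries of
  \<open>x\<close> may be real, as for the eigenvalue bound, or complex, as for the oscillators.\<close>

lemma laplacian_quadratic_form:
  fixes A :: "real ^ 'n ^ 'n" and x :: "'a::real_inner ^ 'n"
  assumes sym: "\<And>l k. A $ l $ k = A $ k $ l"
  shows "(\<Sum>l\<in>UNIV. \<Sum>k\<in>UNIV. A $ l $ k * (x $ l \<bullet> (x $ l - x $ k))) =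
         (\<Sum>l\<in>UNIV. \<Sum>k\<in>UNIV. A $ l $ k * (norm (x $ l - x $ k))\<^sup>2) / 2"
    (is "?S = ?Q / 2")
proof -
  have "?S = (\<Sum>l\<in>UNIV. \<Sum>k\<in>UNIV. A $ l $ k * (x $ k \<bullet> (x $ k - x $ l)))"
    by (subst sum.swap) (simp add: sym[of _ "_::'n"])
  then have "?S + ?S = ?S + (\<Sum>l\<in>UNIV. \<Sum>k\<in>UNIV. A $ l $ k * (x $ k \<bullet> (x $ k - x $ l)))"
    by simp
  also have "\<dots> = ?Q"
    by (simp add: sum.distrib[symmetric] power2_norm_eq_inner inner_diff_left inner_diff_right
        inner_commute algebra_simps)
  finally show ?thesis by simp
qed

lemma adjacency_nonneg: "simple_graph_adjacency A \<Longrightarrow> 0 \<le> A $ l $ k"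
  unfolding simple_graph_adjacency_def by (metis insert_iff order_refl singletonD zero_le_one)

lemma adjacency_sym: "simple_graph_adjacency A \<Longrightarrow> A $ l $ k = A $ k $ l"
  unfolding simple_graph_adjacency_def by blast

lemma laplacian_form_nonneg:
  fixes x :: "'a::real_inner ^ 'n"
  assumes "simple_graph_adjacency A"
  shows "0 \<le> (\<Sum>l\<in>UNIV. \<Sum>k\<in>UNIV. A $ l $ k * (x $ l \<bullet> (x $ l - x $ k)))"
  unfolding laplacian_quadratic_form[OF adjacency_sym[OF assms]]
  using adjacency_nonneg[OF assms] by (auto intro!: sum_nonneg)

text \<open>Projecting all oscillators on the direction \<open>w\<close> gives a real vector \<open>x\<close> with \<open>(L x)\<^sub>l\<close> on the left
  and \<open>\<parallel>x\<parallel> \<le> \<parallel>w\<parallel> \<parallel>z\<parallel>\<close>, so the bound for real vectors suffices.\<close>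

lemma coupling_le_lambda_max:
  fixes z :: "'a::real_inner ^ 'n"
  assumes A: "simple_graph_adjacency A" and "0 \<le> lambda_max (graph_laplacian A)"
  shows "(\<Sum>k\<in>UNIV. A $ l $ k * (w \<bullet> (z $ l - z $ k)))
           \<le> lambda_max (graph_laplacian A) * norm w * norm z"
proof -
  let ?L = "graph_laplacian A"
  define x :: "real ^ 'n" where "x = (\<chi> k. w \<bullet> z $ k)"
  have "transpose ?L = ?L"
    using adjacency_sym[OF A] by (auto simp: transpose_def graph_laplacian_def vec_eq_iff)
  moreover have "0 \<le> y \<bullet> (?L *v y)" for y
    using laplacian_form_nonneg[OF A, of y]
    by (simp add: inner_vec_def graph_laplacian_mult_nth sum_distrib_left mult_ac)
  ultimately have bound: "norm (?L *v x) \<le> lambda_max ?L * norm x"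
    using assms(2) by (rule psd_norm_le_lambda_max)
  have "norm x \<le> norm ((\<chi> k. norm w * norm (z $ k)) :: real ^ 'n)"
    by (rule norm_le_componentwise_cart) (simp add: x_def Cauchy_Schwarz_ineq2)
  also have "(\<chi> k. norm w * norm (z $ k)) = norm w *\<^sub>R (\<chi> k. norm (z $ k))"
    by (simp add: vec_eq_iff)
  also have "norm \<dots> = norm w * norm z"
    by (simp add: norm_vec_def L2_set_right_distrib)
  finally have x: "norm x \<le> norm w * norm z" .
  have "(\<Sum>k\<in>UNIV. A $ l $ k * (w \<bullet> (z $ l - z $ k))) = (?L *v x) $ l"
    by (simp add: graph_laplacian_mult_nth x_def inner_diff_right)
  also have "\<dots> \<le> norm (?L *v x)"
    using component_le_norm_cart[of "?L *v x" l] by simp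
  also have "\<dots> \<le> lambda_max ?L * (norm w * norm z)"
    using mult_left_mono[OF x assms(2)] bound by simp
  finally show ?thesis by simp
qed

section \<open>The vector field\<close>

text \<open>The field in terms of real scalars, with the rotation \<open>\<i> * z $ l\<close> orthogonal to \<open>z $ l\<close>; this is
  the form suited to inner products.\<close>

lemma sl_field_nth:
  "sl_field A \<mu> \<omega> c z $ l =
     (\<mu> - (cmod (z $ l))\<^sup>2) *\<^sub>R z $ l + (\<omega> $ l) *\<^sub>R (\<i> * z $ l)
     - c *\<^sub>R (\<Sum>k\<in>UNIV. A $ l $ k *\<^sub>R (z $ l - z $ k))"
proof -
  have "(\<Sum>k\<in>UNIV. complex_of_real (A $ l $ k) * (z $ k - z $ l))
        = - (\<Sum>k\<in>UNIV. A $ l $ k *\<^sub>R (z $ l - z $ k))"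
    unfolding sum_negf[symmetric] by (intro sum.cong) (auto simp: scaleR_conv_of_real algebra_simps)
  then show ?thesis
    by (simp add: sl_field_def scaleR_conv_of_real algebra_simps)
qed

lemma inner_ii_mult [simp]: "w \<bullet> (\<i> * w) = 0" for w :: complex
  by (simp add: inner_complex_def)

lemma sl_field_inner_nth:
  "z $ l \<bullet> sl_field A \<mu> \<omega> c z $ l =
     (\<mu> - (cmod (z $ l))\<^sup>2) * (cmod (z $ l))\<^sup>2
     - c * (\<Sum>k\<in>UNIV. A $ l $ k * (z $ l \<bullet> (z $ l - z $ k)))"
  by (simp add: sl_field_nth inner_add_right inner_diff_right[of _ _ "c *\<^sub>R _"] inner_sum_right
      power2_norm_eq_inner)

text \<open>The Laplacian form has a favourable sign, and the sum of the fourth powers is at least \<open>S\<^sup>2 / N\<close>.\<close>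

lemma sl_field_dissipative:
  fixes A :: "real ^ 'n ^ 'n"
  assumes A: "simple_graph_adjacency A" and "0 \<le> c"
  shows "z \<bullet> sl_field A \<mu> \<omega> c z \<le> (\<mu> - (norm z)\<^sup>2 / real CARD('n)) * (norm z)\<^sup>2"
proof -
  have "z \<bullet> sl_field A \<mu> \<omega> c z = (\<Sum>l\<in>UNIV. (\<mu> - (cmod (z $ l))\<^sup>2) * (cmod (z $ l))\<^sup>2)
      - c * (\<Sum>l\<in>UNIV. \<Sum>k\<in>UNIV. A $ l $ k * (z $ l \<bullet> (z $ l - z $ k)))"
    by (simp add: inner_vec_def sl_field_inner_nth sum_subtractf sum_distrib_left)
  also have "\<dots> \<le> (\<Sum>l\<in>UNIV. (\<mu> - (cmod (z $ l))\<^sup>2) * (cmod (z $ l))\<^sup>2)"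
    using laplacian_form_nonneg[OF A, of z] \<open>0 \<le> c\<close> by simp
  also have "\<dots> = \<mu> * (norm z)\<^sup>2 - (\<Sum>l\<in>UNIV. ((cmod (z $ l))\<^sup>2)\<^sup>2)"
    by (simp add: sum_norm_square_vec[of z] sum_distrib_left sum_subtractf
        left_diff_distrib power2_eq_square[of "_\<^sup>2"])
  also have "((norm z)\<^sup>2)\<^sup>2 \<le> (\<Sum>l\<in>UNIV. ((cmod (z $ l))\<^sup>2)\<^sup>2) * real CARD('n)"
    unfolding sum_norm_square_vec by (rule sum_squared_le_sum_of_squares)
  then have "\<mu> * (norm z)\<^sup>2 - (\<Sum>l\<in>UNIV. ((cmod (z $ l))\<^sup>2)\<^sup>2)
      \<le> (\<mu> - (norm z)\<^sup>2 / real CARD('n)) * (norm z)\<^sup>2"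
    by (simp add: field_simps power2_eq_square)
  finally show ?thesis .
qed

text \<open>The map \<open>a \<mapsto> \<parallel>a\<parallel>\<^sup>2 a\<close> is the gradient of the convex function \<open>\<parallel>a\<parallel>\<^sup>4 / 4\<close>.\<close>

lemma cubic_monotone: "0 \<le> (a - b) \<bullet> ((norm a)\<^sup>2 *\<^sub>R a - (norm b)\<^sup>2 *\<^sub>R b)"
  for a b :: "'a::real_inner"
proof -
  have "2 * ((a - b) \<bullet> ((norm a)\<^sup>2 *\<^sub>R a - (norm b)\<^sup>2 *\<^sub>R b)) =
      ((norm a)\<^sup>2 + (norm b)\<^sup>2) * (norm (a - b))\<^sup>2 + ((norm a)\<^sup>2 - (norm b)\<^sup>2)\<^sup>2"
    unfolding power2_norm_eq_inner
    by (simp add: inner_diff_left inner_diff_right inner_commute power2_eq_square algebra_simps)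
  moreover have "0 \<le> ((norm a)\<^sup>2 + (norm b)\<^sup>2) * (norm (a - b))\<^sup>2 + ((norm a)\<^sup>2 - (norm b)\<^sup>2)\<^sup>2"
    by (intro add_nonneg_nonneg mult_nonneg_nonneg) auto
  ultimately show ?thesis by linarith
qed

text \<open>Only the linear growth term can separate two solutions: the rotation is skew, the cubic term is
  monotone and the coupling contracts.\<close>

lemma sl_field_one_sided_Lipschitz:
  fixes z w :: "complex ^ 'n"
  assumes A: "simple_graph_adjacency A" and "0 \<le> c"
  shows "(z - w) \<bullet> (sl_field A \<mu> \<omega> c z - sl_field A \<mu> \<omega> c w) \<le> \<mu> * (norm (z - w))\<^sup>2"
proof -
  let ?d = "z - w"
  have "?d $ l \<bullet> (sl_field A \<mu> \<omega> c z - sl_field A \<mu> \<omega> c w) $ l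
      \<le> \<mu> * (norm (?d $ l))\<^sup>2 - c * (\<Sum>k\<in>UNIV. A $ l $ k * (?d $ l \<bullet> (?d $ l - ?d $ k)))" for l
  proof -
    have "(sl_field A \<mu> \<omega> c z - sl_field A \<mu> \<omega> c w) $ l =
        \<mu> *\<^sub>R ?d $ l - ((norm (z $ l))\<^sup>2 *\<^sub>R z $ l - (norm (w $ l))\<^sup>2 *\<^sub>R w $ l)
        + (\<omega> $ l) *\<^sub>R (\<i> * ?d $ l) - c *\<^sub>R (\<Sum>k\<in>UNIV. A $ l $ k *\<^sub>R (?d $ l - ?d $ k))"
      by (simp add: sl_field_nth algebra_simps scaleR_diff_right sum_subtractf sum.distrib)
    then show ?thesis
      using cubic_monotone[of "z $ l" "w $ l"]
      by (simp add: inner_add_right inner_diff_right[of _ _ "c *\<^sub>R _"]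
          inner_diff_right[of _ "_ *\<^sub>R _" "_ - _"] inner_sum_right power2_norm_eq_inner
          del: vector_minus_component) simp
  qed
  then have "?d \<bullet> (sl_field A \<mu> \<omega> c z - sl_field A \<mu> \<omega> c w)
      \<le> (\<Sum>l\<in>UNIV. \<mu> * (norm (?d $ l))\<^sup>2
          - c * (\<Sum>k\<in>UNIV. A $ l $ k * (?d $ l \<bullet> (?d $ l - ?d $ k))))"
    unfolding inner_vec_def by (intro sum_mono)
  also have "\<dots> = \<mu> * (norm ?d)\<^sup>2
      - c * (\<Sum>l\<in>UNIV. \<Sum>k\<in>UNIV. A $ l $ k * (?d $ l \<bullet> (?d $ l - ?d $ k)))"
    by (simp add: sum_norm_square_vec sum_subtractf sum_distrib_left)
  also have "\<dots> \<le> \<mu> * (norm ?d)\<^sup>2"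
    using laplacian_form_nonneg[OF A, of ?d] \<open>0 \<le> c\<close> by (simp del: vector_minus_component)
  finally show ?thesis .
qed

lemma cubic_Lipschitz:
  fixes a b :: "'a::real_normed_vector"
  assumes "norm a \<le> R" "norm b \<le> R"
  shows "norm ((norm a)\<^sup>2 *\<^sub>R a - (norm b)\<^sup>2 *\<^sub>R b) \<le> 3 * R\<^sup>2 * norm (a - b)"
proof -
  have "(norm a)\<^sup>2 *\<^sub>R a - (norm b)\<^sup>2 *\<^sub>R b
      = (norm a)\<^sup>2 *\<^sub>R (a - b) + ((norm a - norm b) * (norm a + norm b)) *\<^sub>R b"
    by (simp add: algebra_simps power2_eq_square)
  also have "norm \<dots> \<le> (norm a)\<^sup>2 * norm (a - b) + \<bar>norm a - norm b\<bar> * (norm a + norm b) * norm b"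
    by (rule norm_triangle_le) (simp add: abs_mult)
  also have "\<dots> \<le> R\<^sup>2 * norm (a - b) + norm (a - b) * (R + R) * R"
    using assms norm_triangle_ineq3[of a b] order_trans[OF norm_ge_zero assms(1)]
    by (intro add_mono mult_mono power_mono) auto
  finally show ?thesis
    by (simp add: power2_eq_square algebra_simps)
qed

definition cubic_damping :: "complex ^ 'n \<Rightarrow> complex ^ 'n" where
  "cubic_damping z = (\<chi> l. (cmod (z $ l))\<^sup>2 *\<^sub>R z $ l)"

lemma cubic_damping_Lipschitz:
  fixes z w :: "complex ^ 'n"
  assumes "norm z \<le> R" "norm w \<le> R"
  shows "norm (cubic_damping z - cubic_damping w) \<le> 3 * R\<^sup>2 * norm (z - w)"
proof -
  have "norm (cubic_damping z - cubic_damping w) \<le> norm ((3 * R\<^sup>2) *\<^sub>R (z - w))"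
  proof (rule norm_le_componentwise_cart)
    fix l
    have "norm (z $ l) \<le> R" "norm (w $ l) \<le> R"
      using order_trans[OF Finite_Cartesian_Product.norm_nth_le assms(1)] order_trans[OF Finite_Cartesian_Product.norm_nth_le assms(2)] .
    then show "norm ((cubic_damping z - cubic_damping w) $ l) \<le> norm (((3 * R\<^sup>2) *\<^sub>R (z - w)) $ l)"
      using cubic_Lipschitz[of "z $ l" R "w $ l"] by (simp add: cubic_damping_def)
  qed
  then show ?thesis by simp
qed

text \<open>The cubic damping is the only obstruction to a global Lipschitz bound, so it alone has to be
  cut off.\<close>

lemma linear_sl_field_plus_cubic:
  fixes A :: "real ^ 'n ^ 'n"
  shows "linear (\<lambda>z. sl_field A \<mu> \<omega> c z + cubic_damping z)"
proof -
  have nth: "(sl_field A \<mu> \<omega> c z + cubic_damping z) $ l =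
      \<mu> *\<^sub>R z $ l + (\<omega> $ l) *\<^sub>R (\<i> * z $ l) - c *\<^sub>R (\<Sum>k\<in>UNIV. A $ l $ k *\<^sub>R (z $ l - z $ k))" for z :: "complex ^ 'n" and l
    by (simp add: sl_field_nth cubic_damping_def algebra_simps)
  show ?thesis
  proof (rule linearI)
    fix z w :: "complex ^ 'n"
    show "sl_field A \<mu> \<omega> c (z + w) + cubic_damping (z + w) =
      (sl_field A \<mu> \<omega> c z + cubic_damping z) + (sl_field A \<mu> \<omega> c w + cubic_damping w)"
      unfolding vec_eq_iff vector_add_component[of "_ + _" "_ + _"] nth
      by (simp add: algebra_simps sum.distrib sum_subtractf scaleR_add_right scaleR_diff_right)
  next
    fix a :: real and z :: "complex ^ 'n"
    show "sl_field A \<mu> \<omega> c (a *\<^sub>R z) + cubic_damping (a *\<^sub>R z) =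
      a *\<^sub>R (sl_field A \<mu> \<omega> c z + cubic_damping z)"
      unfolding vec_eq_iff vector_scaleR_component nth
      by (simp add: algebra_simps scaleR_sum_right sum_subtractf scaleR_diff_right)
  qed
qed

section \<open>Existence and uniqueness of oscillator trajectories\<close>

lemma has_real_derivative_norm_square:
  fixes x :: "real \<Rightarrow> 'a::real_inner"
  assumes "(x has_vector_derivative x') (at t within S)"
  shows "((\<lambda>s. (norm (x s))\<^sup>2) has_real_derivative 2 * (x t \<bullet> x')) (at t within S)"
proof -
  have "((\<lambda>s. x s \<bullet> x s) has_derivative (\<lambda>h. x t \<bullet> (h *\<^sub>R x') + (h *\<^sub>R x') \<bullet> x t)) (at t within S)"
    using assms unfolding has_vector_derivative_def by (intro has_derivative_inner)
  then show ?thesis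
    unfolding has_field_derivative_def power2_norm_eq_inner
    by (rule has_derivative_eq_rhs) (auto simp: inner_commute)
qed

text \<open>The damping is evaluated at the nearest point of the ball of radius \<open>sqrt (N \<mu>)\<close>, and the
  nearest-point map is nonexpansive. Along the modified solution \<open>p = N \<mu> - S\<close> satisfies \<open>p' \<ge> - 2 \<mu> p\<close> as
  long as \<open>p > 0\<close>, so it stays positive and the modification is never felt.\<close>

lemma sl_solution_exists_bounded:
  fixes A :: "real ^ 'n ^ 'n" and z0 :: "complex ^ 'n"
  assumes A: "simple_graph_adjacency A" and "0 < \<mu>" "0 \<le> c"
    and z0: "(norm z0)\<^sup>2 < real CARD('n) * \<mu>"
  obtains z where "z 0 = z0" "sl_solution_on {0..} A \<mu> \<omega> c z"
    "\<And>t. 0 \<le> t \<Longrightarrow> (norm (z t))\<^sup>2 < real CARD('n) * \<mu>"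
proof -
  define N where "N = real CARD('n)"
  define R where "R = sqrt (N * \<mu>)"
  have N: "0 < N" "0 < R" "R\<^sup>2 = N * \<mu>"
    using \<open>0 < \<mu>\<close> by (auto simp: N_def R_def)
  define Lin where "Lin z = sl_field A \<mu> \<omega> c z + cubic_damping z" for z
  define f where "f z = Lin z - cubic_damping (closest_point (cball 0 R) z)" for z
  have inside: "f z = sl_field A \<mu> \<omega> c z" if "norm z \<le> R" for z
    using that by (simp add: f_def Lin_def closest_point_self)
  have lin: "linear Lin"
    unfolding Lin_def by (rule linear_sl_field_plus_cubic)
  obtain B where B: "\<And>z. norm (Lin z) \<le> B * norm z"
    using linear_bounded[OF lin] by blast
  have "norm (f z - f w) \<le> (B + 3 * R\<^sup>2) * norm (z - w)" for z w
  proof -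
    let ?p = "closest_point (cball 0 R) :: complex ^ 'n \<Rightarrow> _"
    have p: "norm (?p x) \<le> R" for x
      using closest_point_in_set[of "cball 0 R" x] N by auto
    have "norm (cubic_damping (?p z) - cubic_damping (?p w)) \<le> 3 * R\<^sup>2 * norm (?p z - ?p w)"
      by (intro cubic_damping_Lipschitz p)
    also have "\<dots> \<le> 3 * R\<^sup>2 * norm (z - w)"
      using closest_point_lipschitz[of "cball 0 R" z w] N(2)
      by (intro mult_left_mono) (auto simp: dist_norm)
    finally have "norm (cubic_damping (?p z) - cubic_damping (?p w)) \<le> 3 * R\<^sup>2 * norm (z - w)" .
    moreover have "f z - f w = Lin (z - w) - (cubic_damping (?p z) - cubic_damping (?p w))"
      by (simp add: f_def linear_diff[OF lin])
    ultimately show ?thesis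
      using norm_triangle_ineq4[of "Lin (z - w)" "cubic_damping (?p z) - cubic_damping (?p w)"] B[of "z - w"]
      by (simp add: distrib_right)
  qed
  then obtain z where z: "z 0 = z0"
      "\<And>t. 0 \<le> t \<Longrightarrow> (z has_vector_derivative f (z t)) (at t within {0..})"
    using global_solution_of_Lipschitz_field by metis
  (* The inequality for p is not strict. A barrier that decays at the faster rate 3 * \<mu> makes the
     sign at contact strict. Starting it at half of p keeps time 0 free of contact. *)
  define \<epsilon> where "\<epsilon> = (N * \<mu> - (norm z0)\<^sup>2) / 2"
  have \<epsilon>: "0 < \<epsilon>"
    using z0 by (simp add: \<epsilon>_def N_def)
  have bound: "0 < N * \<mu> - (norm (z t))\<^sup>2 - \<epsilon> * exp (- 3 * \<mu> * t)" if "0 \<le> t" for t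
  proof (rule barrier_positive[where T = t and g = "\<lambda>_::unit. \<lambda>t. N * \<mu> - (norm (z t))\<^sup>2 - \<epsilon> * exp (- 3 * \<mu> * t)"
        and g' = "\<lambda>_ t. - 2 * (z t \<bullet> f (z t)) + 3 * \<mu> * \<epsilon> * exp (- 3 * \<mu> * t)"])
    show "0 < N * \<mu> - (norm (z 0))\<^sup>2 - \<epsilon> * exp (- 3 * \<mu> * 0)"
      using \<epsilon> z(1) by (simp add: \<epsilon>_def)
  next
    fix t :: real assume "0 \<le> t"
    show "((\<lambda>t. N * \<mu> - (norm (z t))\<^sup>2 - \<epsilon> * exp (- 3 * \<mu> * t)) has_real_derivative
        - 2 * (z t \<bullet> f (z t)) + 3 * \<mu> * \<epsilon> * exp (- 3 * \<mu> * t)) (at t within {0..})"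
      by (rule derivative_eq_intros has_real_derivative_norm_square[OF z(2)[OF \<open>0 \<le> t\<close>]] refl)+ simp
  next
    fix t :: real assume "N * \<mu> - (norm (z t))\<^sup>2 - \<epsilon> * exp (- 3 * \<mu> * t) = 0"
    then have p: "N * \<mu> - (norm (z t))\<^sup>2 = \<epsilon> * exp (- 3 * \<mu> * t)" (is "_ = ?p") by simp
    have "0 < ?p" using \<epsilon> by simp
    then have S: "(norm (z t))\<^sup>2 \<le> R\<^sup>2"
      using p N by linarith
    have "z t \<bullet> f (z t) \<le> (\<mu> - (norm (z t))\<^sup>2 / N) * (norm (z t))\<^sup>2"
      using inside[OF power2_le_imp_le[OF S]] N sl_field_dissipative[OF A \<open>0 \<le> c\<close>] by (simp add: N_def)
    also have "\<mu> - (norm (z t))\<^sup>2 / N = ?p / N"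
      unfolding p[symmetric] using N by (simp add: diff_divide_distrib)
    also have "?p / N * (norm (z t))\<^sup>2 = (norm (z t))\<^sup>2 / N * ?p"
      by simp
    also have "\<dots> \<le> \<mu> * ?p"
      using S N \<open>0 < ?p\<close> by (intro mult_right_mono) (auto simp: field_simps)
    finally show "0 < - 2 * (z t \<bullet> f (z t)) + 3 * \<mu> * \<epsilon> * exp (- 3 * \<mu> * t)"
      using mult_pos_pos[OF \<open>0 < \<mu>\<close> \<open>0 < ?p\<close>] by simp
  qed (use that in auto)
  have lt: "(norm (z t))\<^sup>2 < N * \<mu>" if "0 \<le> t" for t
    using bound[OF that] mult_pos_pos[OF \<epsilon> exp_gt_zero[of "- 3 * \<mu> * t"]] by linarith
  have "norm (z t) \<le> R" if "0 \<le> t" for t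
    by (rule power2_le_imp_le) (use lt[OF that] N in linarith)+
  then have "sl_solution_on {0..} A \<mu> \<omega> c z"
    unfolding sl_solution_on_def using z(2) inside by (metis atLeast_iff)
  then show ?thesis
    using that[of z] z(1) lt by (simp add: N_def)
qed

text \<open>By the one-sided Lipschitz bound the squared distance of two solutions, multiplied by
  \<open>exp (- 2 \<mu> t)\<close>, does not increase.\<close>

lemma sl_solution_unique:
  assumes A: "simple_graph_adjacency A" and "0 \<le> c"
    and J: "is_interval J" "0 \<in> J" "J \<subseteq> {0..}"
    and z: "sl_solution_on J A \<mu> \<omega> c z" and w: "sl_solution_on J A \<mu> \<omega> c w"
    and "z 0 = w 0" and "t \<in> J"
  shows "z t = w t"
proof -
  have "0 \<le> t"
    using J(3) \<open>t \<in> J\<close> by auto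
  have sub: "{0..t} \<subseteq> J"
    using mem_is_interval_1_I[OF J(1,2) \<open>t \<in> J\<close>] by (simp add: subset_eq)
  define \<phi> where "\<phi> s = exp (- 2 * \<mu> * s) * (norm (z s - w s))\<^sup>2" for s
  define \<phi>' where "\<phi>' s = exp (- 2 * \<mu> * s) * (2 * ((z s - w s) \<bullet>
      (sl_field A \<mu> \<omega> c (z s) - sl_field A \<mu> \<omega> c (w s))) - 2 * \<mu> * (norm (z s - w s))\<^sup>2)" for s
  have der: "(\<phi> has_real_derivative \<phi>' s) (at s within {0..t})" if "s \<in> {0..t}" for s
  proof -
    have "((\<lambda>s. z s - w s) has_vector_derivative sl_field A \<mu> \<omega> c (z s) - sl_field A \<mu> \<omega> c (w s))
        (at s within {0..t})"
      using z w subsetD[OF sub that] unfolding sl_solution_on_def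
      by (intro has_vector_derivative_diff has_vector_derivative_within_subset[OF _ sub]) blast+
    note der_norm = has_real_derivative_norm_square[OF this]
    have der_exp: "((\<lambda>s. exp (- 2 * \<mu> * s)) has_real_derivative - 2 * \<mu> * exp (- 2 * \<mu> * s))
        (at s within {0..t})"
      by (auto intro!: derivative_eq_intros)
    show ?thesis
      unfolding \<phi>_def \<phi>'_def
      by (rule DERIV_cong[OF DERIV_mult[OF der_exp der_norm]]) (simp add: algebra_simps)
  qed
  have "\<phi>' s \<le> 0" for s
    using sl_field_one_sided_Lipschitz[OF A \<open>0 \<le> c\<close>, of "z s" "w s" \<mu> \<omega>]
    unfolding \<phi>'_def by (intro mult_nonneg_nonpos) simp_all
  moreover have "(\<phi> has_real_derivative \<phi>' s) (at s)" if "0 < s" "s < t" for s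
    using der[of s] that by (simp add: at_within_Icc_at)
  moreover have "continuous_on {0..t} \<phi>"
    using DERIV_continuous[OF der] by (simp add: continuous_on_eq_continuous_within)
  ultimately have "\<phi> t \<le> \<phi> 0"
    using \<open>0 \<le> t\<close> by (intro DERIV_nonpos_imp_decreasing_open[of 0 t \<phi>]) iprover+
  also have "\<phi> 0 = 0"
    using \<open>z 0 = w 0\<close> by (simp add: \<phi>_def)
  finally show ?thesis
    by (simp add: \<phi>_def mult_le_0_iff)
qed

section \<open>Amplitude bounds\<close>

text \<open>The threshold \<open>c_star\<close> is the value of \<open>c\<close> at which the constant term of the cubic equation reaches the maximum of
  \<open>\<mu> x - x\<^sup>3\<close>, attained at \<open>m = sqrt (\<mu> / 3)\<close>; below it the intermediate value theorem gives a root
  in \<open>{0..m}\<close>. Positivity of \<open>\<lambda>\<^sub>m\<^sub>a\<^sub>x\<close> can be read off from \<open>0 < c < c_star\<close>.\<close>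

lemma r_star_root:
  fixes A :: "real ^ 'n ^ 'n"
  assumes "0 < \<mu>" "0 < c" "c < c_star A \<mu>"
  shows "0 < lambda_max (graph_laplacian A)" and "0 < r_star A \<mu> c"
    and "\<mu> * r_star A \<mu> c - r_star A \<mu> c ^ 3 =
      c * sqrt (real CARD('n) * \<mu>) * lambda_max (graph_laplacian A)"
proof -
  define N where "N = real CARD('n)"
  define \<Lambda> where "\<Lambda> = lambda_max (graph_laplacian A)"
  define K where "K = c * sqrt (N * \<mu>) * \<Lambda>"
  define X where "X = {x. 0 < x \<and> \<mu> * x - x ^ 3 = K}"
  have N: "0 < N" by (simp add: N_def)
  have c: "c < 2 * \<mu> / (3 * sqrt (3 * N) * \<Lambda>)"
    using assms(3) by (simp add: c_star_def N_def \<Lambda>_def)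
  then have "0 < 2 * \<mu> / (3 * sqrt (3 * N) * \<Lambda>)"
    using assms(2) by linarith
  then show "0 < lambda_max (graph_laplacian A)"
    using assms(1) N by (simp add: zero_less_divide_iff zero_less_mult_iff \<Lambda>_def)
  then have \<Lambda>: "0 < \<Lambda>" by (simp add: \<Lambda>_def)
  define m where "m = sqrt (\<mu> / 3)"
  have m: "0 < m" "\<mu> = 3 * m ^ 2"
    using assms(1) by (auto simp: m_def)
  have K0: "0 < K"
    using assms N \<Lambda> by (simp add: K_def)
  have "K = (c * (3 * sqrt (3 * N) * \<Lambda>)) * (m / 3)"
    using N by (simp add: K_def m_def real_sqrt_mult real_sqrt_divide)
  also have "c * (3 * sqrt (3 * N) * \<Lambda>) < 2 * \<mu>"
    using c N \<Lambda> by (simp add: pos_less_divide_eq)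
  then have "(c * (3 * sqrt (3 * N) * \<Lambda>)) * (m / 3) < 2 * \<mu> * (m / 3)"
    using m by (intro mult_strict_right_mono) auto
  also have "\<dots> = \<mu> * m - m ^ 3"
    unfolding m(2) by (simp add: power3_eq_cube power2_eq_square)
  finally have "\<exists>x. 0 \<le> x \<and> x \<le> m \<and> \<mu> * x - x ^ 3 = K"
    using m K0 by (intro IVT') (auto intro!: continuous_intros)
  then obtain x where "0 \<le> x" "\<mu> * x - x ^ 3 = K" by blast
  then have "x \<in> X"
    using K0 by (cases "x = 0") (auto simp: X_def)
  (* The minimum defining r_star is meaningful only because a cubic has finitely many roots. *)
  have "X \<subseteq> {x. (\<Sum>i\<le>3. [- K, \<mu>, 0, - 1] ! i * x ^ i) = 0}"
    by (auto simp: X_def numeral_3_eq_3)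
  moreover have "finite {x. (\<Sum>i\<le>3. [- K, \<mu>, 0, - 1] ! i * x ^ i) = 0}"
    by (rule polyfun_rootbound_finite) (rule exI[of _ 3], simp)
  ultimately have "finite X"
    by (rule finite_subset)
  then have "Min X \<in> X"
    using \<open>x \<in> X\<close> by (intro Min_in) auto
  moreover have "r_star A \<mu> c = Min X"
    by (simp add: r_star_def X_def K_def N_def \<Lambda>_def)
  ultimately have "r_star A \<mu> c \<in> X"
    by simp
  then show "0 < r_star A \<mu> c"
    and "\<mu> * r_star A \<mu> c - r_star A \<mu> c ^ 3 =
      c * sqrt (real CARD('n) * \<mu>) * lambda_max (graph_laplacian A)"
    by (auto simp: X_def K_def N_def \<Lambda>_def)
qed

text \<open>Squared amplitudes are differentiable also where an amplitude vanishes, so the barriers below are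
  stated for them.\<close>

lemma sl_solution_nth_norm_square_derivative:
  assumes "sl_solution_on S A \<mu> \<omega> c z" "t \<in> S"
  shows "((\<lambda>s. (cmod (z s $ l))\<^sup>2) has_real_derivative
           2 * (z t $ l \<bullet> sl_field A \<mu> \<omega> c (z t) $ l)) (at t within S)"
  using assms unfolding sl_solution_on_def
  by (intro has_real_derivative_norm_square
      bounded_linear.has_vector_derivative[OF bounded_linear_vec_nth]) blast

text \<open>At contact the growth term \<open>(\<mu> - r\<^sup>*\<^sup>2) r\<^sup>*\<^sup>2\<close> equals \<open>c \<lambda>\<^sub>m\<^sub>a\<^sub>x sqrt (N \<mu>) r\<^sup>*\<close> by the choice of
  \<open>r\<^sup>*\<close>, while the coupling takes away at most \<open>c \<lambda>\<^sub>m\<^sub>a\<^sub>x \<parallel>z\<parallel> r\<^sup>*\<close>, which is strictly less.\<close>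

lemma amplitude_stays_above_r_star:
  fixes A :: "real ^ 'n ^ 'n" and z :: "real \<Rightarrow> complex ^ 'n"
  assumes A: "simple_graph_adjacency A" and c: "0 < \<mu>" "0 < c" "c < c_star A \<mu>"
    and sol: "sl_solution_on {0..} A \<mu> \<omega> c z"
    and ball: "\<And>t. 0 \<le> t \<Longrightarrow> (norm (z t))\<^sup>2 < real CARD('n) * \<mu>"
    and init: "\<And>l. r_star A \<mu> c < cmod (z 0 $ l)"
    and "0 \<le> t"
  shows "r_star A \<mu> c < cmod (z t $ l)"
proof -
  let ?r = "r_star A \<mu> c" and ?\<Lambda> = "lambda_max (graph_laplacian A)"
  note r = r_star_root[OF c]
  have "0 < (cmod (z t $ l))\<^sup>2 - ?r\<^sup>2"
  proof (rule barrier_positive[where T = t and g = "\<lambda>l t. (cmod (z t $ l))\<^sup>2 - ?r\<^sup>2"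
        and g' = "\<lambda>l t. 2 * (z t $ l \<bullet> sl_field A \<mu> \<omega> c (z t) $ l)"])
    fix l show "0 < (cmod (z 0 $ l))\<^sup>2 - ?r\<^sup>2"
      using init[of l] r(2) by (simp add: power_strict_mono)
  next
    fix l t assume "0 \<le> (t :: real)"
    then show "((\<lambda>t. (cmod (z t $ l))\<^sup>2 - ?r\<^sup>2) has_real_derivative
        2 * (z t $ l \<bullet> sl_field A \<mu> \<omega> c (z t) $ l)) (at t within {0..})"
      using DERIV_diff[OF sl_solution_nth_norm_square_derivative[OF sol] DERIV_const] by simp
  next
    fix l t assume "0 < (t :: real)" "(cmod (z t $ l))\<^sup>2 - ?r\<^sup>2 = 0"
    then have touch: "cmod (z t $ l) = ?r"
      using r(2) by (simp add: power2_eq_iff_nonneg)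
    have "norm (z t) < sqrt (real CARD('n) * \<mu>)"
      using ball[of t] \<open>0 < t\<close> real_less_rsqrt by simp
    then have "c * (?\<Lambda> * ?r * norm (z t)) < c * (?\<Lambda> * ?r * sqrt (real CARD('n) * \<mu>))"
      using c r by (intro mult_strict_left_mono) auto
    also have "\<dots> = (\<mu> * ?r - ?r ^ 3) * ?r"
      unfolding r(3) by simp
    also have "\<dots> = (\<mu> - ?r\<^sup>2) * ?r\<^sup>2"
      by (simp add: power2_eq_square power3_eq_cube algebra_simps)
    finally have "c * (?\<Lambda> * ?r * norm (z t)) < (\<mu> - ?r\<^sup>2) * ?r\<^sup>2" .
    moreover have "c * (\<Sum>k\<in>UNIV. A $ l $ k * (z t $ l \<bullet> (z t $ l - z t $ k)))
        \<le> c * (?\<Lambda> * ?r * norm (z t))"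
      using coupling_le_lambda_max[OF A, of l "z t $ l" "z t"] r(1) c touch
      by (intro mult_left_mono) auto
    ultimately have "0 < z t $ l \<bullet> sl_field A \<mu> \<omega> c (z t) $ l"
      unfolding sl_field_inner_nth touch by (smt (verit))
    then show "0 < 2 * (z t $ l \<bullet> sl_field A \<mu> \<omega> c (z t) $ l)"
      by simp
  qed (use \<open>0 \<le> t\<close> in auto)
  then show ?thesis
    using power2_less_imp_less[of ?r "cmod (z t $ l)"] by simp
qed

text \<open>The barrier \<open>b = sqrt \<mu> + e\<close> with \<open>e' = - \<mu> e\<close> is a strict supersolution of \<open>r' = (\<mu> - r\<^sup>2) r\<close>, since
  \<open>(b\<^sup>2 - \<mu>) b \<ge> 2 \<mu> e\<close>. At contact the touching amplitude is maximal, so the coupling cannot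
  increase it.\<close>

lemma amplitude_below_decaying_barrier:
  fixes A :: "real ^ 'n ^ 'n" and z :: "real \<Rightarrow> complex ^ 'n"
  assumes A: "simple_graph_adjacency A" and c: "0 < \<mu>" "0 \<le> c" and "0 < C"
    and sol: "sl_solution_on {0..} A \<mu> \<omega> c z"
    and init: "\<And>l. cmod (z 0 $ l) < sqrt \<mu> + C"
    and "0 \<le> t"
  shows "cmod (z t $ l) < sqrt \<mu> + C * exp (- \<mu> * t)"
proof -
  define e where "e t = C * exp (- \<mu> * t)" for t
  define b where "b t = sqrt \<mu> + e t" for t
  have e: "0 < e t" for t
    using \<open>0 < C\<close> by (simp add: e_def)
  have b: "sqrt \<mu> < b t" "0 < b t" for t
    using e[of t] c(1) by (auto simp: b_def add_pos_pos)
  have "0 < (b t)\<^sup>2 - (cmod (z t $ l))\<^sup>2"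
  proof (rule barrier_positive[where T = t and g = "\<lambda>l t. (b t)\<^sup>2 - (cmod (z t $ l))\<^sup>2"
        and g' = "\<lambda>l t. 2 * b t * (- \<mu> * e t) - 2 * (z t $ l \<bullet> sl_field A \<mu> \<omega> c (z t) $ l)"])
    fix l show "0 < (b 0)\<^sup>2 - (cmod (z 0 $ l))\<^sup>2"
      using init[of l] by (simp add: power_strict_mono b_def e_def)
  next
    fix l t assume "0 \<le> (t :: real)"
    have "((\<lambda>t. (b t)\<^sup>2) has_real_derivative 2 * b t * (- \<mu> * e t)) (at t within {0..})"
      unfolding b_def e_def by (auto intro!: derivative_eq_intros)
    then show "((\<lambda>t. (b t)\<^sup>2 - (cmod (z t $ l))\<^sup>2) has_real_derivative
        2 * b t * (- \<mu> * e t) - 2 * (z t $ l \<bullet> sl_field A \<mu> \<omega> c (z t) $ l)) (at t within {0..})"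
      using \<open>0 \<le> t\<close> by (intro DERIV_diff sl_solution_nth_norm_square_derivative[OF sol]) auto
  next
    fix l t assume nonneg: "\<And>k. 0 \<le> (b t)\<^sup>2 - (cmod (z t $ k))\<^sup>2"
      and "(b t)\<^sup>2 - (cmod (z t $ l))\<^sup>2 = 0"
    then have touch: "cmod (z t $ l) = b t"
      using b(2)[of t] by (simp add: power2_eq_iff_nonneg)
    have "0 \<le> z t $ l \<bullet> (z t $ l - z t $ k)" for k
    proof -
      have "cmod (z t $ k) \<le> b t"
        using nonneg[of k] b(2)[of t] power2_le_imp_le[of "cmod (z t $ k)" "b t"] by simp
      then have "b t * cmod (z t $ k) \<le> b t * b t"
        using b(2)[of t] by (intro mult_left_mono) auto
      then have "z t $ l \<bullet> z t $ k \<le> b t * b t"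
        using norm_cauchy_schwarz[of "z t $ l" "z t $ k"] unfolding touch by linarith
      then show ?thesis
        by (simp add: inner_diff_right dot_square_norm touch power2_eq_square)
    qed
    then have "0 \<le> c * (\<Sum>k\<in>UNIV. A $ l $ k * (z t $ l \<bullet> (z t $ l - z t $ k)))"
      using adjacency_nonneg[OF A] c(2) by (intro mult_nonneg_nonneg sum_nonneg) auto
    moreover have "(\<mu> - (b t)\<^sup>2) * (b t)\<^sup>2 < b t * (- \<mu> * e t)"
    proof -
      have "\<mu> * e t < 2 * sqrt \<mu> * e t * sqrt \<mu>"
        using c(1) e[of t] by simp
      also have "\<dots> \<le> ((b t)\<^sup>2 - \<mu>) * b t"
        using c(1) e[of t] b[of t] by (intro mult_mono) (auto simp: b_def power2_sum)
      finally have "b t * (\<mu> * e t) < b t * (((b t)\<^sup>2 - \<mu>) * b t)"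
        using b(2)[of t] by (rule mult_strict_left_mono)
      then show ?thesis
        by (simp add: power2_eq_square algebra_simps)
    qed
    ultimately have "z t $ l \<bullet> sl_field A \<mu> \<omega> c (z t) $ l < b t * (- \<mu> * e t)"
      unfolding sl_field_inner_nth touch by (smt (verit))
    then show "0 < 2 * b t * (- \<mu> * e t) - 2 * (z t $ l \<bullet> sl_field A \<mu> \<omega> c (z t) $ l)"
      by (simp add: algebra_simps)
  qed (use \<open>0 \<le> t\<close> in auto)
  then have "cmod (z t $ l) < b t"
    using power2_less_imp_less[of "cmod (z t $ l)" "b t"] b(2)[of t] by simp
  then show ?thesis
    by (simp add: b_def e_def)
qed

lemma amplitude_Limsup_le:
  fixes A :: "real ^ 'n ^ 'n" and z :: "real \<Rightarrow> complex ^ 'n"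
  assumes A: "simple_graph_adjacency A" and c: "0 < \<mu>" "0 \<le> c"
    and sol: "sl_solution_on {0..} A \<mu> \<omega> c z"
  shows "Limsup at_top (\<lambda>t. ereal (MAX l. amplitude z t $ l)) \<le> ereal (sqrt \<mu>)"
proof -
  define C where "C = 1 + norm (z 0)"
  have C: "0 < C" by (simp add: C_def add_pos_nonneg)
  have init: "cmod (z 0 $ l) < sqrt \<mu> + C" for l
    using Finite_Cartesian_Product.norm_nth_le[of "z 0" l] real_sqrt_gt_zero[OF c(1)]
    unfolding C_def by linarith
  have "(MAX l. amplitude z t $ l) \<le> sqrt \<mu> + C * exp (- \<mu> * t)" if "0 \<le> t" for t
    using amplitude_below_decaying_barrier[OF A c C sol init that]
    by (auto simp: amplitude_def intro: less_imp_le)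
  then have "\<forall>\<^sub>F t in at_top. ereal (MAX l. amplitude z t $ l) \<le> ereal (sqrt \<mu> + C * exp (- \<mu> * t))"
    by (intro eventually_mono[OF eventually_ge_at_top[of 0]]) (simp only: ereal_less_eq)
  then have "Limsup at_top (\<lambda>t. ereal (MAX l. amplitude z t $ l))
      \<le> Limsup at_top (\<lambda>t. ereal (sqrt \<mu> + C * exp (- \<mu> * t)))"
    by (rule Limsup_mono)
  also have "((\<lambda>t. sqrt \<mu> + C * exp (- \<mu> * t)) \<longlongrightarrow> sqrt \<mu> + C * 0) at_top"
    using c(1) by (intro tendsto_intros filterlim_compose[OF exp_at_bot]
        filterlim_tendsto_neg_mult_at_bot[OF tendsto_const] filterlim_ident) auto
  then have "Limsup at_top (\<lambda>t. ereal (sqrt \<mu> + C * exp (- \<mu> * t))) = ereal (sqrt \<mu>)"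
    by (intro lim_imp_Limsup) auto
  finally show ?thesis .
qed

section \<open>Polar coordinates\<close>

lemma has_vector_derivative_vec_iff:
  fixes z :: "real \<Rightarrow> 'a::euclidean_space ^ 'n"
  shows "(z has_vector_derivative D) (at t within S) \<longleftrightarrow>
    (\<forall>l. ((\<lambda>s. z s $ l) has_vector_derivative D $ l) (at t within S))"
proof -
  have "(z has_vector_derivative D) (at t within S) \<longleftrightarrow>
      (\<forall>l. \<forall>u\<in>Basis. ((\<lambda>s. z s $ l \<bullet> u) has_derivative (\<lambda>h. (h *\<^sub>R D $ l) \<bullet> u)) (at t within S))"
    unfolding has_vector_derivative_def has_derivative_componentwise_within[of z]
    by (simp add: Basis_vec_def inner_axis)
  moreover have "((\<lambda>s. z s $ l) has_vector_derivative D $ l) (at t within S) \<longleftrightarrow>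
      (\<forall>u\<in>Basis. ((\<lambda>s. z s $ l \<bullet> u) has_derivative (\<lambda>h. (h *\<^sub>R D $ l) \<bullet> u)) (at t within S))" for l
    unfolding has_vector_derivative_def by (rule has_derivative_componentwise_within)
  ultimately show ?thesis
    by simp
qed

lemma has_vector_derivative_polar:
  assumes "(r has_real_derivative r') (at t within S)" "(\<theta> has_real_derivative \<theta>') (at t within S)"
  shows "((\<lambda>s. complex_of_real (r s) * exp (\<i> * complex_of_real (\<theta> s))) has_vector_derivative
    Complex r' (r t * \<theta>') * exp (\<i> * complex_of_real (\<theta> t))) (at t within S)"
proof -
  have "((\<lambda>s. \<i> * complex_of_real (\<theta> s)) has_vector_derivative \<i> * complex_of_real \<theta>') (at t within S)"
    using assms(2) by (intro has_vector_derivative_mult_right has_vector_derivative_of_real)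
  then have "(exp \<circ> (\<lambda>s. \<i> * complex_of_real (\<theta> s)) has_vector_derivative
      \<i> * complex_of_real \<theta>' * exp (\<i> * complex_of_real (\<theta> t))) (at t within S)"
    by (rule field_vector_diff_chain_within) (auto intro!: DERIV_subset[OF DERIV_exp])
  from has_vector_derivative_mult[OF has_vector_derivative_of_real[OF assms(1)] this[unfolded o_def]]
  show ?thesis
    by (rule has_vector_derivative_eq_rhs) (simp add: Complex_eq algebra_simps)
qed

text \<open>The number \<open>E\<close> is the velocity \<open>D\<close> seen in the frame rotating with the angle: its real part is
  radial and its imaginary part tangential. The substance is that \<open>r\<close> and \<open>\<theta>\<close> are differentiable at
  all when \<open>z\<close> is: near \<open>t\<close> the angle moves by less than \<open>pi\<close>, so the principal logarithm of
  \<open>z s / z t\<close> is exactly \<open>ln (r s / r t) + i (\<theta> s - \<theta> t)\<close>.\<close>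

lemma polar_derivative_iff:
  fixes r \<theta> :: "real \<Rightarrow> real" and D :: complex
  assumes t: "t \<in> S" and pos: "\<And>s. s \<in> S \<Longrightarrow> 0 < r s" and cont: "continuous_on S \<theta>"
  defines "E \<equiv> D * exp (- (\<i> * complex_of_real (\<theta> t)))"
  shows "((\<lambda>s. complex_of_real (r s) * exp (\<i> * complex_of_real (\<theta> s))) has_vector_derivative D)
      (at t within S) \<longleftrightarrow>
    (r has_real_derivative Re E) (at t within S) \<and>
    (\<theta> has_real_derivative Im E / r t) (at t within S)"
    (is "(?z has_vector_derivative D) _ \<longleftrightarrow> ?rhs")
proof
  assume ?rhs
  then have "(?z has_vector_derivative Complex (Re E) (r t * (Im E / r t)) *
      exp (\<i> * complex_of_real (\<theta> t))) (at t within S)"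
    by (intro has_vector_derivative_polar) auto
  moreover have "Complex (Re E) (r t * (Im E / r t)) = E"
    using pos[OF t] by (simp add: complex_eq_iff)
  moreover have "E * exp (\<i> * complex_of_real (\<theta> t)) = D"
    by (simp add: E_def exp_minus)
  ultimately show "(?z has_vector_derivative D) (at t within S)"
    by simp
next
  assume D: "(?z has_vector_derivative D) (at t within S)"
  define h where "h s = Complex (ln (r s / r t)) (\<theta> s - \<theta> t)" for s
  have exp_h: "exp (h s) = ?z s / ?z t" if "s \<in> S" for s
  proof -
    have "exp (h s) = exp (complex_of_real (ln (r s / r t))) * exp (\<i> * complex_of_real (\<theta> s - \<theta> t))"
      by (simp add: h_def Complex_eq exp_add)
    also have "exp (complex_of_real (ln (r s / r t))) = complex_of_real (r s / r t)"
      using pos[OF that] pos[OF t] by (simp add: exp_of_real)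
    finally show ?thesis
      by (simp add: exp_diff right_diff_distrib)
  qed
  have zt: "?z t \<noteq> 0"
    using pos[OF t] by simp
  have "((\<lambda>s. ?z s / ?z t) has_vector_derivative D / ?z t) (at t within S)"
    by (rule has_vector_derivative_divide[OF D])
  moreover have "(Ln has_field_derivative 1) (at (?z t / ?z t) within (\<lambda>s. ?z s / ?z t) ` S)"
    using has_field_derivative_Ln[of 1] zt by (auto intro: DERIV_subset)
  ultimately have Ln_deriv: "(Ln \<circ> (\<lambda>s. ?z s / ?z t) has_vector_derivative D / ?z t * 1) (at t within S)"
    by (rule field_vector_diff_chain_within)
  obtain d where d: "0 < d" "\<And>s. s \<in> S \<Longrightarrow> dist s t < d \<Longrightarrow> dist (\<theta> s) (\<theta> t) < pi"
    using cont t pi_gt_zero unfolding continuous_on_iff by blast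
  have Ln_eq: "(Ln \<circ> (\<lambda>s. ?z s / ?z t)) s = h s" if "s \<in> S" "dist s t < d" for s
    using d(2)[OF that] unfolding comp_def exp_h[OF that(1), symmetric]
    by (intro Ln_exp) (auto simp: h_def dist_real_def)
  have "(h has_vector_derivative D / ?z t) (at t within S)"
    using has_vector_derivative_transform_within[OF Ln_deriv d(1) t Ln_eq] by simp
  moreover have Dz: "D / ?z t = E / r t"
    by (simp add: E_def exp_minus field_simps)
  ultimately have ln_r: "((\<lambda>s. ln (r s / r t)) has_real_derivative Re E / r t) (at t within S)"
    and \<theta>: "((\<lambda>s. \<theta> s - \<theta> t) has_real_derivative Im E / r t) (at t within S)"
    unfolding has_vector_derivative_complex_iff by (simp_all add: h_def)
  have "((\<lambda>s. r t * exp (ln (r s / r t))) has_real_derivative r t * (exp (ln (r t / r t)) * (Re E / r t)))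
      (at t within S)"
    by (intro DERIV_cmult DERIV_chain2[OF DERIV_exp] ln_r)
  then have "((\<lambda>s. r t * exp (ln (r s / r t))) has_real_derivative Re E) (at t within S)"
    using pos[OF t] by simp
  moreover have "r t * exp (ln (r s / r t)) = r s" if "s \<in> S" for s
    using pos[OF t] pos[OF that] by simp
  ultimately have "(r has_real_derivative Re E) (at t within S)"
    by (rule has_field_derivative_transform_within[OF _ zero_less_one t])
  moreover have "(\<theta> has_real_derivative Im E / r t) (at t within S)"
    using DERIV_add[OF \<theta> DERIV_const[of "\<theta> t"]] by simp
  ultimately show ?rhs by simp
qed

text \<open>In the frame of oscillator \<open>l\<close> its own phase is \<open>0\<close> and its neighbours appear at their phase
  differences, which produces the cosines and sines of the polar system.\<close>

lemma sl_field_from_polar: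
  fixes A :: "real ^ 'n ^ 'n" and \<omega> :: "real ^ 'n" and \<mu> c :: real and r \<theta> :: "real \<Rightarrow> real ^ 'n"
  defines "E \<equiv> \<lambda>l t. sl_field A \<mu> \<omega> c (from_polar r \<theta> t) $ l * exp (- (\<i> * complex_of_real (\<theta> t $ l)))"
  shows "Re (E l t) = (\<mu> - (r t $ l)\<^sup>2) * r t $ l
      + c * (\<Sum>k\<in>UNIV. A $ l $ k * (r t $ k * cos (\<theta> t $ k - \<theta> t $ l) - r t $ l))"
    and "Im (E l t) = \<omega> $ l * r t $ l
      + c * (\<Sum>k\<in>UNIV. A $ l $ k * (r t $ k * sin (\<theta> t $ k - \<theta> t $ l)))"
proof -
  let ?u = "\<lambda>k. exp (\<i> * complex_of_real (\<theta> t $ k))"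
  let ?v = "exp (- (\<i> * complex_of_real (\<theta> t $ l)))"
  have rot: "?u k * ?v = cis (\<theta> t $ k - \<theta> t $ l)" for k
    by (simp add: exp_add[symmetric] cis_conv_exp algebra_simps)
  have "E l t = (\<mu> - (r t $ l)\<^sup>2) *\<^sub>R (complex_of_real (r t $ l) * (?u l * ?v))
      + (\<omega> $ l) *\<^sub>R (\<i> * (complex_of_real (r t $ l) * (?u l * ?v)))
      - c *\<^sub>R (\<Sum>k\<in>UNIV. A $ l $ k *\<^sub>R (complex_of_real (r t $ l) * (?u l * ?v)
          - complex_of_real (r t $ k) * (?u k * ?v)))"
    unfolding E_def sl_field_nth
    by (simp add: from_polar_def norm_mult algebra_simps sum_distrib_left sum_distrib_right
        scaleR_conv_of_real)
  also have "\<dots> = (\<mu> - (r t $ l)\<^sup>2) *\<^sub>R complex_of_real (r t $ l)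
      + (\<omega> $ l) *\<^sub>R (\<i> * complex_of_real (r t $ l))
      - c *\<^sub>R (\<Sum>k\<in>UNIV. A $ l $ k *\<^sub>R (complex_of_real (r t $ l)
          - complex_of_real (r t $ k) * cis (\<theta> t $ k - \<theta> t $ l)))"
    by (simp only: rot diff_self cis_zero mult_1_right)
  finally have E: "E l t = \<dots>" .
  have flip: "(\<Sum>k\<in>UNIV. A $ l $ k * (f k - g k)) = - (\<Sum>k\<in>UNIV. A $ l $ k * (g k - f k))" for f g
    by (simp add: sum_negf[symmetric] algebra_simps)
  show "Re (E l t) = (\<mu> - (r t $ l)\<^sup>2) * r t $ l
      + c * (\<Sum>k\<in>UNIV. A $ l $ k * (r t $ k * cos (\<theta> t $ k - \<theta> t $ l) - r t $ l))"
    unfolding E by (subst flip) simp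
  show "Im (E l t) = \<omega> $ l * r t $ l
      + c * (\<Sum>k\<in>UNIV. A $ l $ k * (r t $ k * sin (\<theta> t $ k - \<theta> t $ l)))"
    unfolding E by (simp add: sum_negf)
qed

lemma sl_solution_iff_polar_solution:
  fixes r \<theta> :: "real \<Rightarrow> real ^ 'n"
  assumes pos: "\<And>t l. t \<in> S \<Longrightarrow> 0 < r t $ l" and cont: "continuous_on S \<theta>"
  shows "sl_solution_on S A \<mu> \<omega> c (from_polar r \<theta>) \<longleftrightarrow> polar_solution_on S A \<mu> \<omega> c r \<theta>"
proof -
  have "(from_polar r \<theta> has_vector_derivative sl_field A \<mu> \<omega> c (from_polar r \<theta> t)) (at t within S) \<longleftrightarrow>
    (\<forall>l. ((\<lambda>s. r s $ l) has_real_derivative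
        (\<mu> - (r t $ l)\<^sup>2) * r t $ l
        + c * (\<Sum>k\<in>UNIV. A $ l $ k * (r t $ k * cos (\<theta> t $ k - \<theta> t $ l) - r t $ l)))
       (at t within S) \<and>
     ((\<lambda>s. \<theta> s $ l) has_real_derivative
        \<omega> $ l
        + c * (\<Sum>k\<in>UNIV. A $ l $ k * (r t $ k / r t $ l) * sin (\<theta> t $ k - \<theta> t $ l)))
       (at t within S))" if t: "t \<in> S" for t
  proof -
    have Im: "(\<omega> $ l * r t $ l + c * (\<Sum>k\<in>UNIV. A $ l $ k * (r t $ k * sin (\<theta> t $ k - \<theta> t $ l)))) / r t $ l
        = \<omega> $ l + c * (\<Sum>k\<in>UNIV. A $ l $ k * (r t $ k / r t $ l) * sin (\<theta> t $ k - \<theta> t $ l))" for l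
    proof -
      have "(\<Sum>k\<in>UNIV. A $ l $ k * (r t $ k / r t $ l) * sin (\<theta> t $ k - \<theta> t $ l)) =
          (\<Sum>k\<in>UNIV. A $ l $ k * (r t $ k * sin (\<theta> t $ k - \<theta> t $ l))) / r t $ l"
        by (simp add: sum_divide_distrib mult.assoc)
      then show ?thesis
        using pos[OF t, of l] by (simp add: add_divide_distrib)
    qed
    have comp: "(\<lambda>s. from_polar r \<theta> s $ l) =
        (\<lambda>s. complex_of_real (r s $ l) * exp (\<i> * complex_of_real (\<theta> s $ l)))" for l
      by (simp add: from_polar_def)
    have cont_nth: "continuous_on S (\<lambda>s. \<theta> s $ l)" for l
      using cont by (intro continuous_intros)
    have polar: "((\<lambda>s. complex_of_real (r s $ l) * exp (\<i> * complex_of_real (\<theta> s $ l)))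
          has_vector_derivative D) (at t within S) \<longleftrightarrow>
        ((\<lambda>s. r s $ l) has_real_derivative Re (D * exp (- (\<i> * complex_of_real (\<theta> t $ l)))))
          (at t within S) \<and>
        ((\<lambda>s. \<theta> s $ l) has_real_derivative
          Im (D * exp (- (\<i> * complex_of_real (\<theta> t $ l)))) / r t $ l) (at t within S)" for l D
      by (rule polar_derivative_iff[OF t pos cont_nth])
    show ?thesis
      unfolding has_vector_derivative_vec_iff comp polar sl_field_from_polar Im by (rule refl)
  qed
  then show ?thesis
    unfolding sl_solution_on_def polar_solution_on_def by blast
qed

section \<open>Unwrapped angles\<close>

lemma unwrapped_angles_exist:
  fixes z :: "real \<Rightarrow> complex ^ 'n"
  assumes cont: "continuous_on {0..} z" and nz: "\<And>t l. 0 \<le> t \<Longrightarrow> z t $ l \<noteq> 0"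
  shows "\<exists>\<theta>. unwrapped_angles z \<theta>"
proof -
  have "\<exists>g. continuous_on {0..} g \<and> (\<forall>t\<ge>0. z t $ l = exp (g t))" for l
  proof -
    have "continuous_on {0..} (\<lambda>t. z t $ l)"
      by (intro continuous_intros cont)
    then obtain g where "continuous_on {0..} g" "\<And>t. t \<in> {0..} \<Longrightarrow> z t $ l = exp (g t)"
      using continuous_logarithm_on_contractible[of "{0..}" "\<lambda>t. z t $ l"] nz
        convex_imp_contractible[OF convex_real_interval(1)] by auto
    then show ?thesis by auto
  qed
  then obtain g where g: "\<And>l. continuous_on {0..} (g l)" "\<And>l t. 0 \<le> t \<Longrightarrow> z t $ l = exp (g l t)"
    by metis
  have "unwrapped_angles z (\<lambda>t. \<chi> l. Im (g l t))"
    unfolding unwrapped_angles_def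
  proof (intro conjI allI impI)
    show "continuous_on {0..} (\<lambda>t. \<chi> l. Im (g l t))"
      by (intro continuous_intros g)
    fix t l assume "0 \<le> (t :: real)"
    have "exp (g l t) = complex_of_real (cmod (z t $ l)) * exp (\<i> * complex_of_real (Im (g l t)))"
      unfolding g(2)[OF \<open>0 \<le> t\<close>]
      by (subst exp_eq_polar) (simp add: norm_exp_eq_Re cis_conv_exp)
    then show "exp (\<i> * complex_of_real ((\<chi> l. Im (g l t)) $ l)) =
        z t $ l / complex_of_real (amplitude z t $ l)"
      unfolding amplitude_def g(2)[OF \<open>0 \<le> t\<close>, of l, symmetric]
      using nz[OF \<open>0 \<le> t\<close>, of l] by (simp add: nonzero_eq_divide_eq mult.commute)
  qed
  then show ?thesis by blast
qed

text \<open>Two angles of the same point differ by a multiple of \<open>2 * pi\<close>, and a continuous integer-valued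
  function on a connected set is constant.\<close>

lemma unwrapped_angles_unique:
  fixes z :: "real \<Rightarrow> complex ^ 'n"
  assumes \<theta>: "unwrapped_angles z \<theta>" and \<theta>': "unwrapped_angles z \<theta>'"
    and nz: "\<And>t. 0 \<le> t \<Longrightarrow> z t $ l \<noteq> 0"
  shows "\<exists>m::int. \<forall>t\<ge>0. \<theta>' t $ l = \<theta> t $ l + 2 * pi * of_int m"
proof -
  define f where "f t = (\<theta>' t $ l - \<theta> t $ l) / (2 * pi)" for t
  have int: "f t \<in> \<int>" if "0 \<le> t" for t
  proof -
    have "exp (\<i> * complex_of_real (\<theta>' t $ l)) = exp (\<i> * complex_of_real (\<theta> t $ l))"
      using \<theta> \<theta>' nz[OF that] that by (simp add: unwrapped_angles_def amplitude_def)
    then obtain m :: int where "\<i> * complex_of_real (\<theta>' t $ l) =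
        \<i> * complex_of_real (\<theta> t $ l) + of_int (2 * m) * pi * \<i>"
      unfolding exp_eq by auto
    then have "Im (\<i> * complex_of_real (\<theta>' t $ l)) =
        Im (\<i> * complex_of_real (\<theta> t $ l) + of_int (2 * m) * pi * \<i>)"
      by simp
    then have "f t = of_int m"
      by (simp add: f_def)
    then show ?thesis by simp
  qed
  have "f constant_on {0..}"
  proof (rule continuous_discrete_range_constant)
    show "continuous_on {0..} f"
      using \<theta> \<theta>' unfolding f_def unwrapped_angles_def by (intro continuous_intros) auto
    show "\<exists>e>0. \<forall>y. y \<in> {0..} \<and> f y \<noteq> f x \<longrightarrow> e \<le> norm (f y - f x)" if "x \<in> {0..}" for x
    proof (intro exI[of _ 1] conjI allI impI)
      fix y assume y: "y \<in> {0..} \<and> f y \<noteq> f x"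
      then have "f y - f x \<in> \<int>" "f y - f x \<noteq> 0"
        using int[of x] int[of y] that by auto
      then show "1 \<le> norm (f y - f x)"
        using Ints_nonzero_abs_ge1[of "f y - f x"] by simp
    qed simp
  qed simp
  then obtain a where a: "\<And>t. 0 \<le> t \<Longrightarrow> f t = a"
    by (auto simp: constant_on_def)
  moreover obtain m :: int where "a = of_int m"
    using int[of 0] a[of 0] by (auto elim: Ints_cases)
  ultimately have "\<theta>' t $ l = \<theta> t $ l + 2 * pi * of_int m" if "0 \<le> t" for t
    using that by (simp add: f_def field_simps)
  then show ?thesis by blast
qed

lemma unwrapped_angles_from_polar:
  assumes "unwrapped_angles z \<theta>" "0 \<le> t" "\<And>l. z t $ l \<noteq> 0"
  shows "z t = from_polar (amplitude z) \<theta> t"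
  unfolding vec_eq_iff
proof
  fix l
  have "exp (\<i> * complex_of_real (\<theta> t $ l)) = z t $ l / complex_of_real (cmod (z t $ l))"
    using assms(1,2) assms(3)[of l] unfolding unwrapped_angles_def amplitude_def by auto
  then show "z t $ l = from_polar (amplitude z) \<theta> t $ l"
    using assms(3)[of l] by (simp add: from_polar_def amplitude_def)
qed

section \<open>Persistence of the oscillators\<close>

theorem lemma2p2:
  fixes A :: "real ^ 'n ^ 'n"
    and \<mu> c :: real
    and \<omega> :: "real ^ 'n"
    and z0 :: "complex ^ 'n"
  assumes "CARD('n) \<ge> 2"
    and "simple_graph_adjacency A"
    and "connected_graph_adjacency A"
    and "\<mu> > 0"
    and "0 < c" and "c < c_star A \<mu>"
    and "(\<Sum>l\<in>UNIV. (cmod (z0 $ l))\<^sup>2) < real CARD('n) * \<mu>"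
    and "\<And>l. cmod (z0 $ l) > r_star A \<mu> c"
  shows "\<exists>z :: real \<Rightarrow> complex ^ 'n.
      z 0 = z0 \<and> sl_solution_on {0..} A \<mu> \<omega> c z \<and>
      (\<forall>J w. is_interval J \<and> 0 \<in> J \<and> J \<subseteq> {0..} \<and> w 0 = z0 \<and> sl_solution_on J A \<mu> \<omega> c w
         \<longrightarrow> (\<forall>t\<in>J. w t = z t)) \<and>
      (\<forall>t\<ge>0. (\<Sum>l\<in>UNIV. (amplitude z t $ l)\<^sup>2) < real CARD('n) * \<mu> \<and>
              (\<forall>l. amplitude z t $ l > r_star A \<mu> c)) \<and>
      (\<forall>l. \<not> amplitude_death z l) \<and>
      polar_representation_well_defined z \<and>
      (\<forall>\<theta>. unwrapped_angles z \<theta> \<longrightarrow> polar_solution_on {0..} A \<mu> \<omega> c (amplitude z) \<theta>) \<and>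
      (\<forall>r \<theta>. (\<forall>t\<ge>0. \<forall>l. r t $ l > 0) \<and> continuous_on {0..} \<theta> \<longrightarrow>
         (sl_solution_on {0..} A \<mu> \<omega> c (from_polar r \<theta>)
            \<longleftrightarrow> polar_solution_on {0..} A \<mu> \<omega> c r \<theta>)) \<and>
      Limsup at_top (\<lambda>t. ereal (MAX l. amplitude z t $ l)) \<le> ereal (sqrt \<mu>)"
proof -
  let ?N\<mu> = "real CARD('n) * \<mu>"
  note A = assms(2) and c = assms(4,5,6) and init = assms(8)
  have "0 \<le> c"
    using assms(5) by simp
  have "(norm z0)\<^sup>2 < ?N\<mu>"
    using assms(7) by (simp add: sum_norm_square_vec)
  then obtain z where z0: "z 0 = z0" and sol: "sl_solution_on {0..} A \<mu> \<omega> c z"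
    and ball: "\<And>t. 0 \<le> t \<Longrightarrow> (norm (z t))\<^sup>2 < ?N\<mu>"
    using sl_solution_exists_bounded[OF A assms(4) \<open>0 \<le> c\<close>] by metis
  have above: "r_star A \<mu> c < cmod (z t $ l)" if "0 \<le> t" for t l
    using init z0 by (intro amplitude_stays_above_r_star[OF A c sol ball _ that]) auto
  have pos: "0 < amplitude z t $ l" if "0 \<le> t" for t l
    using order.strict_trans[OF r_star_root(2)[OF c] above[OF that]] by (simp add: amplitude_def)
  then have nz: "z t $ l \<noteq> 0" if "0 \<le> t" for t l
    using pos[OF that, of l] by (auto simp: amplitude_def)
  have cont: "continuous_on {0..} z"
    using sol unfolding sl_solution_on_def by (intro continuous_on_vector_derivative) blast
  have polar_iff: "sl_solution_on {0..} A \<mu> \<omega> c (from_polar r \<theta>) \<longleftrightarrow> polar_solution_on {0..} A \<mu> \<omega> c r \<theta>"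
    if "\<forall>t\<ge>0. \<forall>l. 0 < r t $ l" "continuous_on {0..} \<theta>" for r \<theta>
    using that by (intro sl_solution_iff_polar_solution) auto
  show ?thesis
  proof (intro exI[of _ z] conjI allI impI)
    show "z 0 = z0" and "sl_solution_on {0..} A \<mu> \<omega> c z"
      by fact+
  next
    fix J w
    assume J: "is_interval J \<and> 0 \<in> J \<and> J \<subseteq> {0..} \<and> w 0 = z0 \<and> sl_solution_on J A \<mu> \<omega> c w"
    then have "sl_solution_on J A \<mu> \<omega> c z"
      using sol has_vector_derivative_within_subset[of z _ _ "{0..}" J]
      unfolding sl_solution_on_def by (auto simp: subset_eq)
    then show "\<forall>t\<in>J. w t = z t"
      using sl_solution_unique[OF A \<open>0 \<le> c\<close>, of J \<mu> \<omega> w z] J z0 by auto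
  next
    fix t :: real assume "0 \<le> t"
    then show "(\<Sum>l\<in>UNIV. (amplitude z t $ l)\<^sup>2) < ?N\<mu>"
      using ball by (simp add: amplitude_def sum_norm_square_vec)
    show "amplitude z t $ l > r_star A \<mu> c" for l
      using above[OF \<open>0 \<le> t\<close>] by (simp add: amplitude_def)
  next
    show "\<not> amplitude_death z l" for l
      using pos unfolding amplitude_death_def by (metis less_irrefl)
  next
    show "polar_representation_well_defined z"
      unfolding polar_representation_well_defined_def
    proof (intro conjI allI impI)
      show "\<exists>\<theta>. unwrapped_angles z \<theta>"
        by (rule unwrapped_angles_exist[OF cont nz])
      show "z t = from_polar (amplitude z) \<theta> t" if "unwrapped_angles z \<theta>" "0 \<le> t" for \<theta> t
        by (rule unwrapped_angles_from_polar[OF that nz[OF that(2)]])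
      show "\<exists>m::int. \<forall>t\<ge>0. \<theta>' t $ l = \<theta> t $ l + 2 * pi * of_int m"
        if "unwrapped_angles z \<theta> \<and> unwrapped_angles z \<theta>'" for \<theta> \<theta>' l
        using that by (intro unwrapped_angles_unique[OF _ _ nz]) auto
    qed
  next
    fix \<theta> assume \<theta>: "unwrapped_angles z \<theta>"
    have eq: "z t = from_polar (amplitude z) \<theta> t" if "0 \<le> t" for t
      by (rule unwrapped_angles_from_polar[OF \<theta> that nz[OF that]])
    have "sl_solution_on {0..} A \<mu> \<omega> c (from_polar (amplitude z) \<theta>)"
      unfolding sl_solution_on_def
    proof
      fix t :: real assume t: "t \<in> {0..}"
      then have eq_t: "from_polar (amplitude z) \<theta> t = z t"
        using eq[of t] by simp
      have "(z has_vector_derivative sl_field A \<mu> \<omega> c (from_polar (amplitude z) \<theta> t)) (at t within {0..})"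
        unfolding eq_t using sol t unfolding sl_solution_on_def by blast
      then show "(from_polar (amplitude z) \<theta> has_vector_derivative
          sl_field A \<mu> \<omega> c (from_polar (amplitude z) \<theta> t)) (at t within {0..})"
        by (rule has_vector_derivative_transform[OF t, rotated]) (simp add: eq[symmetric])
    qed
    moreover have "continuous_on {0..} \<theta>"
      using \<theta> by (simp add: unwrapped_angles_def)
    ultimately show "polar_solution_on {0..} A \<mu> \<omega> c (amplitude z) \<theta>"
      using polar_iff[of "amplitude z" \<theta>] pos by simp
  next
    show "sl_solution_on {0..} A \<mu> \<omega> c (from_polar r \<theta>) \<longleftrightarrow> polar_solution_on {0..} A \<mu> \<omega> c r \<theta>"
      if "(\<forall>t\<ge>0. \<forall>l. r t $ l > 0) \<and> continuous_on {0..} \<theta>" for r \<theta>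
      using that by (intro polar_iff) auto
  next
    show "Limsup at_top (\<lambda>t. ereal (MAX l. amplitude z t $ l)) \<le> ereal (sqrt \<mu>)"
      by (rule amplitude_Limsup_le[OF A assms(4) \<open>0 \<le> c\<close> sol])
  qed
qed

end
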